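(* Let $\mathcal{A}$ be an almost disjoint family of countable sets. Then the Banach space $C(K_{\mathcal{A}})$ has the continuous separable complementation property if and only if it has the separable complementation property.
   Context: A family $\mathcal{A}$ of infinite sets is almost disjoint if $A\cap B$ is finite for all distinct $A,B\in\mathcal{A}$; "countable sets" means that all its members are countably infinite. Put $X=\bigcup\mathcal{A}$. The compact Hausdorff space $K_{\mathcal{A}}$ has underlying set $X\cup\{l_A: A\in\mathcal{A}\}\cup\{\infty\}$ (the points $l_A$ and $\infty$ being new and distinct); each point of $X$ is isolated, basic neighborhoods of $l_A$ are $\{l_A\}\cup(A\setminus F)$ with $F$ finite, and basic neighborhoods of $\infty$ are $K_{\mathcal{A}}\setminus\bigcup_{i<n}(\{l_{A_i}\}\cup A_i)$ with $A_0,\dots,A_{n-1}\in\mathcal{A}$. $C(K)$ is the Banach space of real-valued continuous functions on $K$ with the supremum norm. A projection on a Banach space $E$ is a bounded linear operator $P:E\to E$ with $P^2=P$; a subspace is complemented if it is the image of a projection. A Banach space $E$ has the separable complementation property (SCP) if every separable subspace of $E$ is contained in a separable complemented subspace. $E$ has the continuous separable complementation property (continuous SCP) if there is a family $\mathcal{F}$ of separable complemented subspaces of $E$ such that $E=\bigcup\mathcal{F}$, $\mathcal{F}$ is up-directed by inclusion, and for every sequence $F_0\subseteq F_1\subseteq\cdots$ in $\mathcal{F}$ the closure of $\bigcup_{n}F_n$ belongs to $\mathcal{F}$. *)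

theory Defs
  imports "HOL-Analysis.Analysis" "HOL-Probability.Discrete_Topology"
begin

section \<open>The space \<open>K\<^sub>\<A>\<close> of an almost disjoint family\<close>

definition almost_disjoint :: "'a set set \<Rightarrow> bool" where
  "almost_disjoint \<A> \<longleftrightarrow>
     (\<forall>A\<in>\<A>. infinite A) \<and> pairwise (\<lambda>A B. finite (A \<inter> B)) \<A>"

text \<open>The points of \<open>K\<^sub>\<A>\<close> are drawn from the following type; the constructors make the new
  points \<open>l\<^sub>A\<close> and \<open>\<infinity>\<close> distinct from each other and from the points of \<open>\<Union>\<A>\<close>.\<close>

datatype 'a kpoint = Pt 'a | Lpt "'a set" | Infty

definition K_points :: "'a set set \<Rightarrow> 'a kpoint set" where
  "K_points \<A> = Pt ` (\<Union>\<A>) \<union> Lpt ` \<A> \<union> {Infty}"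

fun basic_nbhds :: "'a set set \<Rightarrow> 'a kpoint \<Rightarrow> 'a kpoint set set" where
  "basic_nbhds \<A> (Pt x) = {{Pt x}}"
| "basic_nbhds \<A> (Lpt A) = {insert (Lpt A) (Pt ` (A - F)) | F. finite F}"
| "basic_nbhds \<A> Infty =
     {K_points \<A> - (\<Union>A\<in>\<B>. insert (Lpt A) (Pt ` A)) | \<B>. finite \<B> \<and> \<B> \<subseteq> \<A>}"

definition K_space :: "'a set set \<Rightarrow> 'a kpoint topology" where
  "K_space \<A> =
     topology (\<lambda>U. U \<subseteq> K_points \<A> \<and> (\<forall>p\<in>U. \<exists>N\<in>basic_nbhds \<A> p. N \<subseteq> U))"

lemma basic_nbhds_Int:
  assumes "M \<in> basic_nbhds \<A> p" "N \<in> basic_nbhds \<A> p"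
  shows "M \<inter> N \<in> basic_nbhds \<A> p"
proof (cases p)
  case (Lpt A)
  then obtain F G where "finite F" "finite G" "M = insert (Lpt A) (Pt ` (A - F))"
    "N = insert (Lpt A) (Pt ` (A - G))"
    using assms by auto
  then have "M \<inter> N = insert (Lpt A) (Pt ` (A - (F \<union> G)))" "finite (F \<union> G)"
    by auto
  then show ?thesis using Lpt by auto
next
  case Infty
  then obtain \<B> \<C> where "finite \<B>" "\<B> \<subseteq> \<A>" "finite \<C>" "\<C> \<subseteq> \<A>"
    "M = K_points \<A> - (\<Union>A\<in>\<B>. insert (Lpt A) (Pt ` A))"
    "N = K_points \<A> - (\<Union>A\<in>\<C>. insert (Lpt A) (Pt ` A))"
    using assms by auto
  then have "M \<inter> N = K_points \<A> - (\<Union>A\<in>\<B> \<union> \<C>. insert (Lpt A) (Pt ` A))"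
    "finite (\<B> \<union> \<C>)" "\<B> \<union> \<C> \<subseteq> \<A>"
    by auto
  then show ?thesis using Infty by (simp only: basic_nbhds.simps) blast
qed (use assms in auto)

lemma openin_K_space:
  "openin (K_space \<A>) U \<longleftrightarrow>
     U \<subseteq> K_points \<A> \<and> (\<forall>p\<in>U. \<exists>N\<in>basic_nbhds \<A> p. N \<subseteq> U)"
proof -
  have "istopology (\<lambda>U. U \<subseteq> K_points \<A> \<and> (\<forall>p\<in>U. \<exists>N\<in>basic_nbhds \<A> p. N \<subseteq> U))"
    unfolding istopology_def
  proof (intro conjI allI impI)
    fix S T
    assume S: "S \<subseteq> K_points \<A> \<and> (\<forall>p\<in>S. \<exists>N\<in>basic_nbhds \<A> p. N \<subseteq> S)"
      and T: "T \<subseteq> K_points \<A> \<and> (\<forall>p\<in>T. \<exists>N\<in>basic_nbhds \<A> p. N \<subseteq> T)"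
    show "\<forall>p\<in>S \<inter> T. \<exists>N\<in>basic_nbhds \<A> p. N \<subseteq> S \<inter> T"
    proof
      fix p assume "p \<in> S \<inter> T"
      then obtain M N where "M \<in> basic_nbhds \<A> p" "M \<subseteq> S" "N \<in> basic_nbhds \<A> p" "N \<subseteq> T"
        using S T by blast
      then show "\<exists>N\<in>basic_nbhds \<A> p. N \<subseteq> S \<inter> T"
        by (intro bexI[of _ "M \<inter> N"] basic_nbhds_Int) auto
    qed
  next
    fix \<K>
    assume \<K>: "\<forall>S\<in>\<K>. S \<subseteq> K_points \<A> \<and> (\<forall>p\<in>S. \<exists>N\<in>basic_nbhds \<A> p. N \<subseteq> S)"
    show "\<forall>p\<in>\<Union>\<K>. \<exists>N\<in>basic_nbhds \<A> p. N \<subseteq> \<Union>\<K>"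
    proof
      fix p assume "p \<in> \<Union>\<K>"
      then obtain S where S: "S \<in> \<K>" "p \<in> S"
        by blast
      then obtain N where "N \<in> basic_nbhds \<A> p" "N \<subseteq> S"
        using \<K> by meson
      then show "\<exists>N\<in>basic_nbhds \<A> p. N \<subseteq> \<Union>\<K>"
        using S by blast
    qed
  qed auto
  then show ?thesis
    by (simp add: K_space_def)
qed

lemma openin_basic_nbhd:
  assumes \<A>: "almost_disjoint \<A>" and p: "p \<in> K_points \<A>" and N: "N \<in> basic_nbhds \<A> p"
  shows "p \<in> N" "openin (K_space \<A>) N"
proof -
  show "p \<in> N"
    using p N by (cases p) (auto simp: K_points_def)
  show "openin (K_space \<A>) N"
  proof (cases p)
    case (Pt x)
    then show ?thesis
      using p N by (auto simp: openin_K_space)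
  next
    case (Lpt A)
    then obtain F where "finite F" and NF: "N = insert (Lpt A) (Pt ` (A - F))"
      using N by auto
    then have "N \<in> basic_nbhds \<A> (Lpt A)"
      by auto
    moreover have "A \<in> \<A>"
      using p Lpt by (auto simp: K_points_def)
    ultimately show ?thesis
      unfolding openin_K_space using NF by (auto simp: K_points_def)
  next
    case Infty
    then obtain \<B> where \<B>: "finite \<B>" "\<B> \<subseteq> \<A>"
      and NB: "N = K_points \<A> - (\<Union>A\<in>\<B>. insert (Lpt A) (Pt ` A))"
      using N by auto
    have "\<exists>M\<in>basic_nbhds \<A> q. M \<subseteq> N" if q: "q \<in> N" for q
    proof (cases q)
      case (Lpt B)
      then have B: "B \<in> \<A>" "B \<notin> \<B>"
        using q NB by (auto simp: K_points_def)
      have "finite (B \<inter> A)" if "A \<in> \<B>" for A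
        using \<A> B \<B> that by (metis almost_disjoint_def pairwiseD subsetD)
      then have "finite (\<Union>A\<in>\<B>. B \<inter> A)"
        using \<B> by blast
      then have "insert (Lpt B) (Pt ` (B - (\<Union>A\<in>\<B>. B \<inter> A))) \<in> basic_nbhds \<A> q"
        unfolding Lpt basic_nbhds.simps by blast
      moreover have "insert (Lpt B) (Pt ` (B - (\<Union>A\<in>\<B>. B \<inter> A))) \<subseteq> N"
        using B unfolding NB K_points_def by auto
      ultimately show ?thesis
        by blast
    next
      case Infty
      then show ?thesis
        using N \<open>p = Infty\<close> by auto
    qed (use q in auto)
    then show ?thesis
      unfolding openin_K_space using NB by blast
  qed
qed

lemma topspace_K_space [simp]: "topspace (K_space \<A>) = K_points \<A>"
proof
  show "topspace (K_space \<A>) \<subseteq> K_points \<A>"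
    unfolding topspace_def openin_K_space by blast
  have "\<exists>N\<in>basic_nbhds \<A> p. N \<subseteq> K_points \<A>" if "p \<in> K_points \<A>" for p
  proof (cases p)
    case (Lpt A)
    then have "insert (Lpt A) (Pt ` (A - {})) \<subseteq> K_points \<A>"
      using that by (auto simp: K_points_def)
    moreover have "insert (Lpt A) (Pt ` (A - {})) \<in> basic_nbhds \<A> p"
      unfolding Lpt basic_nbhds.simps by blast
    ultimately show ?thesis
      by blast
  next
    case Infty
    have "K_points \<A> - (\<Union>A\<in>{}. insert (Lpt A) (Pt ` A)) \<in> basic_nbhds \<A> p"
      unfolding Infty basic_nbhds.simps by blast
    then show ?thesis
      by blast
  qed (use that in auto)
  then have "openin (K_space \<A>) (K_points \<A>)"
    unfolding openin_K_space by blast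
  then show "K_points \<A> \<subseteq> topspace (K_space \<A>)"
    by (rule openin_subset)
qed

lemma compact_space_K_space:
  assumes "almost_disjoint \<A>"
  shows "compact_space (K_space \<A>)"
  unfolding compact_space_alt
proof (intro allI impI, elim conjE)
  fix \<U>
  assume op: "\<forall>U\<in>\<U>. openin (K_space \<A>) U" and "topspace (K_space \<A>) \<subseteq> \<Union>\<U>"
  then have cov: "K_points \<A> \<subseteq> \<Union>\<U>"
    by simp
  have "Infty \<in> K_points \<A>"
    by (simp add: K_points_def)
  then obtain U0 where U0: "U0 \<in> \<U>" "Infty \<in> U0"
    using cov by blast
  then obtain N where "N \<in> basic_nbhds \<A> Infty" "N \<subseteq> U0"
    using op openin_K_space[of \<A> U0] by blast
  then obtain \<B> where \<B>: "finite \<B>" "\<B> \<subseteq> \<A>"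
    and sub: "K_points \<A> - (\<Union>A\<in>\<B>. insert (Lpt A) (Pt ` A)) \<subseteq> U0"
    unfolding basic_nbhds.simps by blast
  have "\<exists>\<F>. finite \<F> \<and> \<F> \<subseteq> \<U> \<and> insert (Lpt A) (Pt ` A) \<subseteq> \<Union>\<F>" if A: "A \<in> \<B>" for A
  proof -
    have pts: "insert (Lpt A) (Pt ` A) \<subseteq> K_points \<A>"
      using A \<B> by (auto simp: K_points_def)
    then obtain U where U: "U \<in> \<U>" "Lpt A \<in> U"
      using cov by blast
    then obtain N where "N \<in> basic_nbhds \<A> (Lpt A)" "N \<subseteq> U"
      using op openin_K_space[of \<A> U] by blast
    then obtain F where F: "finite F" "insert (Lpt A) (Pt ` (A - F)) \<subseteq> U"
      unfolding basic_nbhds.simps by blast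
    have "\<forall>x\<in>A \<inter> F. \<exists>V\<in>\<U>. Pt x \<in> V"
      using pts cov by blast
    then obtain V where V: "\<And>x. x \<in> A \<inter> F \<Longrightarrow> V x \<in> \<U> \<and> Pt x \<in> V x"
      by metis
    have "insert (Lpt A) (Pt ` A) \<subseteq> \<Union>(insert U (V ` (A \<inter> F)))"
    proof
      fix p assume "p \<in> insert (Lpt A) (Pt ` A)"
      then consider "p = Lpt A" | x where "p = Pt x" "x \<in> A" "x \<in> F" | x where "p = Pt x" "x \<in> A - F"
        by blast
      then show "p \<in> \<Union>(insert U (V ` (A \<inter> F)))"
      proof cases
        case 1
        then show ?thesis using U by simp
      next
        case (2 x)
        then show ?thesis using V[of x] by auto
      next
        case (3 x)
        then have "p \<in> U" using F(2) by blast
        then show ?thesis by simp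
      qed
    qed
    moreover have "insert U (V ` (A \<inter> F)) \<subseteq> \<U>" "finite (insert U (V ` (A \<inter> F)))"
      using V U F(1) by auto
    ultimately show ?thesis
      by meson
  qed
  then obtain \<F> where \<F>: "\<And>A. A \<in> \<B> \<Longrightarrow>
      finite (\<F> A) \<and> \<F> A \<subseteq> \<U> \<and> insert (Lpt A) (Pt ` A) \<subseteq> \<Union>(\<F> A)"
    by metis
  have "K_points \<A> \<subseteq> \<Union>(insert U0 (\<Union>(\<F> ` \<B>)))"
  proof
    fix p assume p: "p \<in> K_points \<A>"
    show "p \<in> \<Union>(insert U0 (\<Union>(\<F> ` \<B>)))"
    proof (cases "p \<in> (\<Union>A\<in>\<B>. insert (Lpt A) (Pt ` A))")
      case True
      then obtain A where "A \<in> \<B>" "p \<in> insert (Lpt A) (Pt ` A)"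
        by blast
      then have "A \<in> \<B>" "p \<in> \<Union>(\<F> A)"
        using \<F>[of A] by (simp, meson subsetD)
      then show ?thesis
        by blast
    qed (use p sub in blast)
  qed
  moreover have "finite (insert U0 (\<Union>(\<F> ` \<B>)))" "insert U0 (\<Union>(\<F> ` \<B>)) \<subseteq> \<U>"
    using \<F> \<B>(1) U0(1) by (simp_all add: UN_subset_iff)
  ultimately show "\<exists>\<F>. finite \<F> \<and> \<F> \<subseteq> \<U> \<and> topspace (K_space \<A>) \<subseteq> \<Union>\<F>"
    unfolding topspace_K_space by meson
qed

lemma Hausdorff_space_K_space:
  assumes \<A>: "almost_disjoint \<A>"
  shows "Hausdorff_space (K_space \<A>)"
proof -
  define sep where "sep = (\<lambda>p q. \<exists>U V. openin (K_space \<A>) U \<and> openin (K_space \<A>) V \<and>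
    p \<in> U \<and> q \<in> V \<and> disjnt U V)"
  have sym: "sep q p" if "sep p q" for p q
    using that unfolding sep_def by (metis disjnt_sym)
  have sepI: "sep p q"
    if "p \<in> K_points \<A>" "q \<in> K_points \<A>" "M \<in> basic_nbhds \<A> p" "N \<in> basic_nbhds \<A> q" "disjnt M N"
    for p q M N
    unfolding sep_def using that
    by (intro exI[of _ M] exI[of _ N] conjI) (simp_all add: openin_basic_nbhd[OF \<A>])
  have PP: "sep (Pt x) (Pt y)"
    if "x \<noteq> y" "Pt x \<in> K_points \<A>" "Pt y \<in> K_points \<A>" for x y
    by (rule sepI[of _ _ "{Pt x}" "{Pt y}"]) (use that in auto)
  have PL: "sep (Pt x) (Lpt A)" if "Pt x \<in> K_points \<A>" "Lpt A \<in> K_points \<A>" for x A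
  proof (rule sepI[of _ _ "{Pt x}" "insert (Lpt A) (Pt ` (A - {x}))"])
    show "insert (Lpt A) (Pt ` (A - {x})) \<in> basic_nbhds \<A> (Lpt A)"
      unfolding basic_nbhds.simps by blast
  qed (use that in \<open>auto simp: disjnt_iff\<close>)
  have PI: "sep (Pt x) Infty" if "Pt x \<in> K_points \<A>" "Infty \<in> K_points \<A>" for x
  proof -
    from that obtain A where "A \<in> \<A>" "x \<in> A"
      unfolding K_points_def by blast
    show ?thesis
    proof (rule sepI[of _ _ "{Pt x}" "K_points \<A> - (\<Union>A\<in>{A}. insert (Lpt A) (Pt ` A))"])
      have "{A} \<subseteq> \<A>"
        using \<open>A \<in> \<A>\<close> by blast
      then show "K_points \<A> - (\<Union>A\<in>{A}. insert (Lpt A) (Pt ` A)) \<in> basic_nbhds \<A> Infty"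
        unfolding basic_nbhds.simps by blast
    qed (use that \<open>x \<in> A\<close> in \<open>auto simp: disjnt_iff\<close>)
  qed
  have LL: "sep (Lpt A) (Lpt B)"
    if "A \<noteq> B" "Lpt A \<in> K_points \<A>" "Lpt B \<in> K_points \<A>" for A B
  proof (rule sepI[of _ _ "insert (Lpt A) (Pt ` (A - A \<inter> B))" "insert (Lpt B) (Pt ` (B - {}))"])
    have "finite (A \<inter> B)"
      using \<A> that by (auto simp: almost_disjoint_def K_points_def dest: pairwiseD)
    then show "insert (Lpt A) (Pt ` (A - A \<inter> B)) \<in> basic_nbhds \<A> (Lpt A)"
      unfolding basic_nbhds.simps by blast
    show "insert (Lpt B) (Pt ` (B - {})) \<in> basic_nbhds \<A> (Lpt B)"
      unfolding basic_nbhds.simps by blast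
  qed (use that in \<open>auto simp: disjnt_iff\<close>)
  have LI: "sep (Lpt A) Infty" if "Lpt A \<in> K_points \<A>" "Infty \<in> K_points \<A>" for A
  proof (rule sepI[of _ _ "insert (Lpt A) (Pt ` (A - {}))"
        "K_points \<A> - (\<Union>A\<in>{A}. insert (Lpt A) (Pt ` A))"])
    show "insert (Lpt A) (Pt ` (A - {})) \<in> basic_nbhds \<A> (Lpt A)"
      unfolding basic_nbhds.simps by blast
    have "{A} \<subseteq> \<A>"
      using that by (auto simp: K_points_def)
    then show "K_points \<A> - (\<Union>A\<in>{A}. insert (Lpt A) (Pt ` A)) \<in> basic_nbhds \<A> Infty"
      unfolding basic_nbhds.simps by blast
  qed (use that in \<open>auto simp: disjnt_iff\<close>)
  have "sep p q" if "p \<noteq> q" "p \<in> K_points \<A>" "q \<in> K_points \<A>" for p q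
    using that by (cases p; cases q) (auto intro: PP PL PI LL LI sym)
  then show ?thesis
    unfolding Hausdorff_space_def sep_def topspace_K_space by blast
qed


section \<open>The Banach space of continuous functions on a compact space\<close>

text \<open>\<open>C(T)\<close> for a topology \<open>T\<close> whose carrier need not be a whole type is realised inside the
  Banach space of all bounded real functions on the type \<open>'k\<close>, which is
  \<open>'k discrete \<Rightarrow>\<^sub>C real\<close> with its supremum norm. Functions are set to \<open>0\<close> off the carrier, so that
  each continuous function on \<open>T\<close> is represented exactly once and the ambient norm is the supremum
  over the carrier; for compact \<open>T\<close> boundedness is no restriction. See \<open>C_space_ex1\<close>,
  \<open>norm_C_space\<close>, \<open>subspace_C_space\<close> and \<open>closed_C_space\<close>.\<close>

definition C_space :: "'k topology \<Rightarrow> ('k discrete \<Rightarrow>\<^sub>C real) set" where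
  "C_space T = {f. continuous_map T euclideanreal (\<lambda>p. apply_bcontfun f (discrete p)) \<and>
                   (\<forall>p. p \<notin> topspace T \<longrightarrow> apply_bcontfun f (discrete p) = 0)}"

lemma C_space_ex1:
  assumes T: "compact_space T" and g: "continuous_map T euclideanreal g"
  shows "\<exists>!f. f \<in> C_space T \<and> (\<forall>p\<in>topspace T. apply_bcontfun f (discrete p) = g p)"
proof (rule ex_ex1I)
  define h where "h = (\<lambda>d. if of_discrete d \<in> topspace T then g (of_discrete d) else 0)"
  have hd: "h (discrete p) = (if p \<in> topspace T then g p else 0)" for p
    by (simp add: h_def discrete_inverse)
  have "compact (g ` topspace T)"
    using image_compactin[OF _ g] T by (simp add: compact_space_def)
  then have "bounded (insert 0 (g ` topspace T))"
    by (simp add: compact_imp_bounded)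
  moreover have "range h \<subseteq> insert 0 (g ` topspace T)"
    by (auto simp: h_def)
  ultimately have "bounded (range h)"
    by (rule bounded_subset)
  moreover have "continuous_on UNIV h"
    unfolding continuous_on_open_vimage[OF open_UNIV] by (simp add: open_discrete)
  ultimately have app: "apply_bcontfun (Bcontfun h) = h"
    by (simp add: Bcontfun_inverse bcontfun_def)
  have "continuous_map T euclideanreal (\<lambda>p. h (discrete p))"
    by (rule continuous_map_eq[OF g]) (simp add: hd)
  then show "\<exists>f. f \<in> C_space T \<and> (\<forall>p\<in>topspace T. apply_bcontfun f (discrete p) = g p)"
    by (intro exI[of _ "Bcontfun h"]) (auto simp: C_space_def app hd)
next
  fix f f'
  assume f: "f \<in> C_space T \<and> (\<forall>p\<in>topspace T. apply_bcontfun f (discrete p) = g p)"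
    and f': "f' \<in> C_space T \<and> (\<forall>p\<in>topspace T. apply_bcontfun f' (discrete p) = g p)"
  show "f = f'"
  proof (rule bcontfun_eqI)
    fix d
    have "apply_bcontfun f (discrete (of_discrete d)) = apply_bcontfun f' (discrete (of_discrete d))"
      using f f' by (cases "of_discrete d \<in> topspace T") (auto simp: C_space_def)
    then show "apply_bcontfun f d = apply_bcontfun f' d"
      by (simp add: of_discrete_inverse)
  qed
qed

lemma norm_C_space:
  assumes f: "f \<in> C_space T" and ne: "topspace T \<noteq> {}"
  shows "norm f = (SUP p\<in>topspace T. \<bar>apply_bcontfun f (discrete p)\<bar>)"
proof (rule antisym)
  have bd: "\<bar>apply_bcontfun f (discrete p)\<bar> \<le> norm f" for p
    using norm_bounded[of f "discrete p"] by simp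
  then show "(SUP p\<in>topspace T. \<bar>apply_bcontfun f (discrete p)\<bar>) \<le> norm f"
    using ne by (intro cSUP_least)
  have ub: "\<bar>apply_bcontfun f (discrete p)\<bar> \<le> (SUP p\<in>topspace T. \<bar>apply_bcontfun f (discrete p)\<bar>)"
    if "p \<in> topspace T" for p
    using that bd by (intro cSUP_upper) (auto intro!: bdd_aboveI2)
  show "norm f \<le> (SUP p\<in>topspace T. \<bar>apply_bcontfun f (discrete p)\<bar>)"
  proof (rule norm_bound)
    fix d
    show "norm (apply_bcontfun f d) \<le> (SUP p\<in>topspace T. \<bar>apply_bcontfun f (discrete p)\<bar>)"
    proof (cases "of_discrete d \<in> topspace T")
      case True
      then show ?thesis
        using ub[of "of_discrete d"] by (simp add: of_discrete_inverse)
    next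
      case False
      then have "apply_bcontfun f (discrete (of_discrete d)) = 0"
        using f unfolding C_space_def by blast
      moreover obtain p where "p \<in> topspace T"
        using ne by blast
      ultimately show ?thesis
        using ub[of p] by (simp add: of_discrete_inverse)
    qed
  qed
qed

lemma subspace_C_space: "subspace (C_space T)"
  unfolding subspace_def C_space_def
  by (auto simp: plus_bcontfun.rep_eq scaleR_bcontfun.rep_eq zero_bcontfun.rep_eq
      intro!: continuous_intros)

lemma closed_C_space: "closed (C_space T)"
  unfolding closed_sequential_limits
proof (intro allI impI, elim conjE)
  fix f l
  assume f: "\<forall>n. f n \<in> C_space T" and lim: "f \<longlonglongrightarrow> l"
  have unif: "uniform_limit UNIV (\<lambda>n. apply_bcontfun (f n)) (apply_bcontfun l) sequentially"
    using lim by (rule tendsto_bcontfun_uniform_limit)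
  have "continuous_map T (Met_TC.mtopology :: real topology) (\<lambda>p. apply_bcontfun l (discrete p))"
  proof (rule Met_TC.continuous_map_uniform_limit[where F = sequentially
        and f = "\<lambda>n p. apply_bcontfun (f n) (discrete p)"])
    show "\<forall>\<^sub>F n in sequentially. continuous_map T Met_TC.mtopology (\<lambda>p. apply_bcontfun (f n) (discrete p))"
      using f by (simp add: C_space_def)
    show "\<forall>\<^sub>F n in sequentially. \<forall>p\<in>topspace T. apply_bcontfun l (discrete p) \<in> UNIV \<and>
        dist (apply_bcontfun (f n) (discrete p)) (apply_bcontfun l (discrete p)) < e"
      if "0 < e" for e
      using uniform_limitD[OF unif that] by eventually_elim simp
  qed simp
  moreover have "apply_bcontfun l (discrete p) = 0" if "p \<notin> topspace T" for p
  proof -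
    have "(\<lambda>n. apply_bcontfun (f n) (discrete p)) \<longlonglongrightarrow> apply_bcontfun l (discrete p)"
      using unif by (rule tendsto_uniform_limitI) simp
    moreover have "(\<lambda>n. apply_bcontfun (f n) (discrete p)) = (\<lambda>n. 0)"
      using f that unfolding C_space_def by auto
    ultimately show ?thesis
      by (simp add: LIMSEQ_const_iff)
  qed
  ultimately show "l \<in> C_space T"
    by (simp add: C_space_def)
qed


section \<open>Separable complementation properties\<close>

text \<open>In this section a Banach space \<open>E\<close> is given as a closed linear subspace of an ambient
  Banach space. A projection is only required to be defined, linear and bounded on \<open>E\<close>; it need
  not extend to an operator on the ambient space.\<close>

definition projection_on :: "'b::real_normed_vector set \<Rightarrow> ('b \<Rightarrow> 'b) \<Rightarrow> bool" where
  "projection_on E P \<longleftrightarrow>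
     P \<in> E \<rightarrow> E \<and>
     (\<forall>x\<in>E. \<forall>y\<in>E. P (x + y) = P x + P y) \<and>
     (\<forall>c. \<forall>x\<in>E. P (c *\<^sub>R x) = c *\<^sub>R P x) \<and>
     (\<exists>B. \<forall>x\<in>E. norm (P x) \<le> B * norm x) \<and>
     (\<forall>x\<in>E. P (P x) = P x)"

definition complemented_in :: "'b::real_normed_vector set \<Rightarrow> 'b set \<Rightarrow> bool" where
  "complemented_in E F \<longleftrightarrow> (\<exists>P. projection_on E P \<and> F = P ` E)"

definition separable_set :: "'b::topological_space set \<Rightarrow> bool" where
  "separable_set S \<longleftrightarrow> separable_space (top_of_set S)"

definition SCP :: "'b::real_normed_vector set \<Rightarrow> bool" where
  "SCP E \<longleftrightarrow>
     (\<forall>S. subspace S \<and> S \<subseteq> E \<and> separable_set S \<longrightarrow>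
        (\<exists>F. S \<subseteq> F \<and> separable_set F \<and> complemented_in E F))"

definition continuous_SCP :: "'b::real_normed_vector set \<Rightarrow> bool" where
  "continuous_SCP E \<longleftrightarrow>
     (\<exists>\<F>. (\<forall>F\<in>\<F>. separable_set F \<and> complemented_in E F) \<and>
          E = \<Union>\<F> \<and>
          (\<forall>F\<in>\<F>. \<forall>G\<in>\<F>. \<exists>H\<in>\<F>. F \<subseteq> H \<and> G \<subseteq> H) \<and>
          (\<forall>F :: nat \<Rightarrow> 'b set. range F \<subseteq> \<F> \<and> (\<forall>n. F n \<subseteq> F (Suc n)) \<longrightarrow> closure (\<Union>n. F n) \<in> \<F>))"

end

theory Submission
  imports Defs
begin

text \<open>Write \<open>E\<close> for \<open>C(K\<^sub>\<A>)\<close>, and for \<open>\<B> \<subseteq> \<A>\<close> let \<open>E\<^sub>\<B>\<close> (\<open>carried \<A> \<B>\<close> below) be the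
  subspace of those functions that take the value \<open>f(\<infinity>)\<close> off the clopen sets \<open>A \<union> {l\<^sub>A}\<close> with
  \<open>A \<in> \<B>\<close>. Continuity at \<open>\<infinity>\<close> puts every function into \<open>E\<^sub>\<B>\<close> for some countable \<open>\<B>\<close>
  (\<open>countably_carried\<close>). For countable \<open>\<B>\<close> the space \<open>E\<^sub>\<B>\<close> is separable, because it is the closed
  span of \<open>1\<close> and of the indicators of the sets \<open>A \<union> {l\<^sub>A}\<close> with \<open>A \<in> \<B>\<close> and of the points of
  \<open>\<Union>\<B>\<close> (\<open>carried_eq_closure_span\<close>). The same description shows that the closed union of an
  increasing sequence of such subspaces is again one (\<open>closure_UN_carried\<close>). So the \<open>E\<^sub>\<B>\<close>
  with \<open>\<B>\<close> countable witness the continuous property as soon as all of them are complemented.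

  The SCP gives this. Up to isomorphism \<open>E\<^sub>\<B>\<close> is the space of continuous functions on a countable
  compact space of height at most three, hence a copy of \<open>c\<^sub>0\<close> when infinite-dimensional, and
  Sobczyk's theorem says that \<open>c\<^sub>0\<close> is complemented in every separable superspace. Here only the
  superspaces \<open>E\<^sub>\<B>\<^sub>'\<close> with \<open>\<B> \<subseteq> \<B>'\<close> countable matter, and for them there is an explicit
  projection (\<open>projection_carried\<close>): make the members of the countable family \<open>\<B>' - \<B>\<close> disjoint
  by finite changes and subtract from \<open>f\<close>, on the part of \<open>\<Union>\<B>\<close> that belongs to \<open>A \<in> \<B>' - \<B>\<close>,
  the constant \<open>f(l\<^sub>A) - f(\<infinity>)\<close>. Given \<open>\<B>\<close>, the SCP yields a projection of \<open>E\<close> onto a separable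
  \<open>F \<supseteq> E\<^sub>\<B>\<close>. Being separable, \<open>F\<close> lies in some \<open>E\<^sub>\<B>\<^sub>'\<close>, and the composition of the two projections
  has range \<open>E\<^sub>\<B>\<close>.

  The converse holds in every space: a dense sequence of a separable subspace is absorbed by an
  increasing sequence in the given family.\<close>

section \<open>Separable subspaces\<close>

lemma separable_setI:
  assumes "countable C" "C \<subseteq> S" "S \<subseteq> closure C"
  shows "separable_set S"
  unfolding separable_set_def separable_space_def
  using assms by (intro exI[of _ C]) (auto simp: closure_of_subtopology Int_absorb1)

lemma separable_setE:
  assumes "separable_set S"
  obtains C where "countable C" "C \<subseteq> S" "S \<subseteq> closure C"
  using assms unfolding separable_set_def separable_space_def
  by (auto simp: closure_of_subtopology Int_absorb1)

text \<open>Up-directedness lets an increasing sequence \<open>H\<close> in the family pick up the terms of a dense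
  sequence one at a time; closedness under limits then gives a single member.\<close>

lemma continuous_SCP_imp_SCP:
  fixes E :: "'b::real_normed_vector set"
  assumes "continuous_SCP E"
  shows "SCP E"
  unfolding SCP_def
proof (intro allI impI, elim conjE)
  fix S :: "'b set"
  assume S: "subspace S" "S \<subseteq> E" "separable_set S"
  obtain \<F> where comp: "\<forall>F\<in>\<F>. separable_set F \<and> complemented_in E F"
    and cover: "E = \<Union>\<F>"
    and directed: "\<forall>F\<in>\<F>. \<forall>G\<in>\<F>. \<exists>H\<in>\<F>. F \<subseteq> H \<and> G \<subseteq> H"
    and chain: "\<forall>F :: nat \<Rightarrow> 'b set. range F \<subseteq> \<F> \<and> (\<forall>n. F n \<subseteq> F (Suc n)) \<longrightarrow>
      closure (\<Union>n. F n) \<in> \<F>"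
    using assms unfolding continuous_SCP_def by (elim exE conjE)
  obtain C where C: "countable C" "C \<subseteq> S" "S \<subseteq> closure C"
    using S(3) by (rule separable_setE)
  have "0 \<in> closure C"
    using S(1) C(3) subspace_0 by blast
  then have "C \<noteq> {}"
    by auto
  then have rangeC: "range (from_nat_into C) = C"
    using C(1) by (rule range_from_nat_into)
  have "\<exists>G\<in>\<F>. from_nat_into C n \<in> G" for n
    using rangeC C(2) S(2) cover by blast
  then obtain G where G: "\<And>n. G n \<in> \<F>" "\<And>n. from_nat_into C n \<in> G n"
    by metis
  obtain ub where ub: "\<And>F G. F \<in> \<F> \<Longrightarrow> G \<in> \<F> \<Longrightarrow> ub F G \<in> \<F> \<and> F \<subseteq> ub F G \<and> G \<subseteq> ub F G"
    using directed by metis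
  define H where "H = rec_nat (G 0) (\<lambda>n F. ub F (G (Suc n)))"
  have H0: "H 0 = G 0" and HSuc: "H (Suc n) = ub (H n) (G (Suc n))" for n
    by (simp_all add: H_def)
  have H: "H n \<in> \<F>" for n
    by (induction n) (simp_all add: H0 HSuc G ub)
  have "H n \<subseteq> H (Suc n)" for n
    using ub[OF H G(1)] by (simp add: HSuc)
  then have limit: "closure (\<Union>n. H n) \<in> \<F>"
    using H by (intro chain[rule_format]) auto
  have "G n \<subseteq> H n" for n
    using ub[OF H G(1)] by (cases n) (simp_all add: H0 HSuc)
  then have "from_nat_into C n \<in> (\<Union>n. H n)" for n
    using G(2)[of n] by (auto intro!: UN_I[of n])
  then have "range (from_nat_into C) \<subseteq> (\<Union>n. H n)"
    by (intro image_subsetI)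
  then have "C \<subseteq> (\<Union>n. H n)"
    unfolding rangeC .
  then have "S \<subseteq> closure (\<Union>n. H n)"
    by (rule order_trans[OF C(3) closure_mono])
  then show "\<exists>F. S \<subseteq> F \<and> separable_set F \<and> complemented_in E F"
    using limit comp by blast
qed

text \<open>Finite rational combinations of the generators, indexed by lists so that countability is
  immediate, are dense.\<close>

lemma separable_closure_span:
  fixes T :: "'b::real_normed_vector set"
  assumes T: "countable T"
  shows "separable_set (closure (span T))"
proof -
  define comb :: "(rat \<times> nat) list \<Rightarrow> 'b" where
    "comb = (\<lambda>l. \<Sum>(q, n)\<leftarrow>l. of_rat q *\<^sub>R from_nat_into T n)"
  define C where "C = (if T = {} then {0} else range comb)"
  have CT: "C \<subseteq> span T"
  proof (cases "T = {}")
    case False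
    have "comb l \<in> span T" for l
    proof (induction l)
      case (Cons a l)
      then show ?case
        using span_add[OF span_scale[OF span_base[OF from_nat_into[OF False]]] Cons]
        by (cases a) (simp add: comb_def)
    qed (simp add: comb_def span_zero)
    then show ?thesis
      by (auto simp: C_def)
  qed (simp add: C_def)
  have C0: "0 \<in> C"
    by (auto simp: C_def comb_def intro!: image_eqI[of _ _ "[]"])
  have "x \<in> closure C" if "x \<in> span T" for x
    using that
  proof (induction x rule: span_induct_alt)
    case base
    then show ?case
      using C0 closure_subset by blast
  next
    case (step c t y)
    then have ne: "T \<noteq> {}"
      by blast
    obtain n where n: "t = from_nat_into T n"
      using step(1) T from_nat_into_surj by metis
    show ?case
      unfolding closure_approachable
    proof (intro allI impI)
      fix e :: real assume e: "e > 0"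
      obtain z where z: "z \<in> C" "dist z y < e/2"
        using step(2) e unfolding closure_approachable by (meson half_gt_zero)
      obtain l where l: "z = comb l"
        using z(1) ne by (auto simp: C_def)
      have "0 < e / (2 * (norm t + 1))"
        using e by (simp add: add_nonneg_pos)
      then obtain q where q: "c < of_rat q" "of_rat q < c + e / (2 * (norm t + 1))"
        using of_rat_dense[of c "c + e / (2 * (norm t + 1))"] by auto
      have "comb ((q, n) # l) = of_rat q *\<^sub>R t + z"
        by (simp add: comb_def l n)
      then have "of_rat q *\<^sub>R t + z \<in> C"
        using ne by (metis C_def rangeI)
      moreover have "dist (of_rat q *\<^sub>R t + z) (c *\<^sub>R t + y) < e"
      proof -
        have "dist (of_rat q *\<^sub>R t + z) (c *\<^sub>R t + y) \<le> \<bar>of_rat q - c\<bar> * norm t + dist z y"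
          using norm_triangle_ineq[of "(of_rat q - c) *\<^sub>R t" "z - y"]
          by (simp only: dist_norm norm_scaleR) (simp add: algebra_simps)
        moreover have "\<bar>of_rat q - c\<bar> * norm t \<le> e/2"
        proof -
          have "\<bar>of_rat q - c\<bar> * norm t \<le> e / (2 * (norm t + 1)) * (norm t + 1)"
            using q by (intro mult_mono) auto
          also have "\<dots> = e/2"
            using add_nonneg_pos[OF norm_ge_zero zero_less_one, of t]
            by (simp add: divide_simps del: distrib_left_numeral)
          finally show ?thesis .
        qed
        ultimately show ?thesis
          using z(2) by linarith
      qed
      ultimately show "\<exists>y'\<in>C. dist y' (c *\<^sub>R t + y) < e"
        by blast
    qed
  qed
  then have "closure (span T) \<subseteq> closure C"
    by (intro closure_minimal) auto
  moreover have "countable C"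
    by (simp add: C_def)
  moreover have "C \<subseteq> closure (span T)"
    using CT closure_subset by blast
  ultimately show ?thesis
    by (intro separable_setI[of C])
qed

section \<open>Evaluating and building elements of \<open>C_space\<close>\<close>

abbreviation val :: "('k discrete \<Rightarrow>\<^sub>C real) \<Rightarrow> 'k \<Rightarrow> real" where
  "val f p \<equiv> apply_bcontfun f (discrete p)"

lemma val_add: "val (f + g) p = val f p + val g p"
  and val_diff: "val (f - g) p = val f p - val g p"
  and val_scale: "val (c *\<^sub>R f) p = c * val f p"
  by (simp_all add: plus_bcontfun.rep_eq minus_bcontfun.rep_eq scaleR_bcontfun.rep_eq)

lemma val_sum: "val (\<Sum>i\<in>I. f i) p = (\<Sum>i\<in>I. val (f i) p)"
  by (induction I rule: infinite_finite_induct)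
    (simp_all add: val_add zero_bcontfun.rep_eq)

lemma abs_val_le: "\<bar>val f p\<bar> \<le> norm f"
  using norm_bounded[of f "discrete p"] by simp

lemma norm_le_val:
  assumes "f \<in> C_space T" "\<And>p. p \<in> topspace T \<Longrightarrow> \<bar>val f p\<bar> \<le> e" "0 \<le> e"
  shows "norm f \<le> e"
proof (rule norm_bound)
  fix d
  have "\<bar>val f (of_discrete d)\<bar> \<le> e"
    using assms by (cases "of_discrete d \<in> topspace T") (auto simp: C_space_def)
  then show "norm (apply_bcontfun f d) \<le> e"
    by (simp add: of_discrete_inverse)
qed

lemma C_space_eqI:
  assumes "f \<in> C_space T" "g \<in> C_space T" "\<And>p. p \<in> topspace T \<Longrightarrow> val f p = val g p"
  shows "f = g"
proof -
  have "f - g \<in> C_space T"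
    by (rule subspace_diff[OF subspace_C_space assms(1,2)])
  then have "norm (f - g) \<le> 0"
    by (rule norm_le_val) (simp_all add: val_diff assms)
  then show ?thesis
    by simp
qed

lemma closed_Collect_val_eq: "closed {f. val f p = val f q}"
proof -
  have "bounded_linear (\<lambda>f :: 'k discrete \<Rightarrow>\<^sub>C real. val f r)" for r
    by (rule bounded_linear_intro[of _ 1]) (simp_all add: val_add val_scale abs_val_le)
  then show ?thesis
    by (intro closed_Collect_eq linear_continuous_on) 
qed

definition mk_C :: "'k topology \<Rightarrow> ('k \<Rightarrow> real) \<Rightarrow> 'k discrete \<Rightarrow>\<^sub>C real" where
  "mk_C T h = (THE f. f \<in> C_space T \<and> (\<forall>p\<in>topspace T. val f p = h p))"

lemma mk_C:
  assumes "compact_space T" "continuous_map T euclideanreal h"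
  shows mk_C_in_C_space: "mk_C T h \<in> C_space T"
    and val_mk_C: "p \<in> topspace T \<Longrightarrow> val (mk_C T h) p = h p"
  using theI'[OF C_space_ex1[OF assms]] unfolding mk_C_def by auto

section \<open>Continuous functions on \<open>K\<^sub>\<A>\<close>\<close>

text \<open>The largest basic neighbourhood of \<open>l\<^sub>A\<close>.\<close>

definition branch :: "'a set \<Rightarrow> 'a kpoint set" where
  "branch A = insert (Lpt A) (Pt ` A)"

lemma branch_simps [simp]:
  "Pt x \<in> branch A \<longleftrightarrow> x \<in> A" "Lpt B \<in> branch A \<longleftrightarrow> B = A" "Infty \<notin> branch A"
  by (auto simp: branch_def)

lemma K_points_simps [simp]:
  "Pt x \<in> K_points \<A> \<longleftrightarrow> x \<in> \<Union>\<A>" "Lpt A \<in> K_points \<A> \<longleftrightarrow> A \<in> \<A>" "Infty \<in> K_points \<A>"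
  by (auto simp: K_points_def)

lemma almost_disjointD:
  "almost_disjoint \<A> \<Longrightarrow> A \<in> \<A> \<Longrightarrow> B \<in> \<A> \<Longrightarrow> A \<noteq> B \<Longrightarrow> finite (A \<inter> B)"
  by (auto simp: almost_disjoint_def dest: pairwiseD)

text \<open>Points of \<open>\<Union>\<A>\<close> are isolated, so continuity is a condition at the \<open>l\<^sub>A\<close> and at \<open>\<infinity>\<close> only. Both
  conditions ask for finiteness of an exceptional set, which suits almost disjointness.\<close>

lemma continuous_map_K_space_iff:
  assumes \<A>: "almost_disjoint \<A>"
  shows "continuous_map (K_space \<A>) euclideanreal h \<longleftrightarrow>
    (\<forall>A\<in>\<A>. \<forall>e>0. finite {x\<in>A. e \<le> \<bar>h (Pt x) - h (Lpt A)\<bar>}) \<and>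
    (\<forall>e>0. \<exists>\<D>. finite \<D> \<and> \<D> \<subseteq> \<A> \<and>
      (\<forall>p\<in>K_points \<A> - (\<Union>A\<in>\<D>. branch A). \<bar>h p - h Infty\<bar> < e))" (is "_ \<longleftrightarrow> ?limits \<and> ?infty")
proof -
  have "continuous_map (K_space \<A>) euclideanreal h \<longleftrightarrow>
    (\<forall>p\<in>K_points \<A>. \<forall>e>0. \<exists>U. openin (K_space \<A>) U \<and> p \<in> U \<and> (\<forall>q\<in>U. \<bar>h q - h p\<bar> < e))"
    using Met_TC.continuous_map_to_metric[of "K_space \<A>" h]
    by (simp add: dist_real_def abs_minus_commute)
  also have "\<dots> \<longleftrightarrow>
    (\<forall>p\<in>K_points \<A>. \<forall>e>0. \<exists>N\<in>basic_nbhds \<A> p. \<forall>q\<in>N. \<bar>h q - h p\<bar> < e)" (is "_ \<longleftrightarrow> ?nbhds")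
    by (meson openin_K_space openin_basic_nbhd[OF \<A>] subsetD)
  also have "\<dots> \<longleftrightarrow> ?limits \<and> ?infty"
  proof (intro iffI conjI ballI allI impI)
    fix A e assume n: "?nbhds" and A: "A \<in> \<A>" and e: "(e::real) > 0"
    then obtain F where "finite F" "\<forall>q\<in>insert (Lpt A) (Pt ` (A - F)). \<bar>h q - h (Lpt A)\<bar> < e"
      using n[rule_format, of "Lpt A" e] by auto
    then show "finite {x\<in>A. e \<le> \<bar>h (Pt x) - h (Lpt A)\<bar>}"
      by (elim finite_subset[rotated]) force
  next
    fix e assume n: "?nbhds" and e: "(e::real) > 0"
    then show "\<exists>\<D>. finite \<D> \<and> \<D> \<subseteq> \<A> \<and>
      (\<forall>p\<in>K_points \<A> - (\<Union>A\<in>\<D>. branch A). \<bar>h p - h Infty\<bar> < e)"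
      using n[rule_format, of Infty e] unfolding branch_def by auto
  next
    fix p e assume lim: "?limits \<and> ?infty" and p: "p \<in> K_points \<A>" and e: "(e::real) > 0"
    show "\<exists>N\<in>basic_nbhds \<A> p. \<forall>q\<in>N. \<bar>h q - h p\<bar> < e"
    proof (cases p)
      case (Pt x)
      then show ?thesis using e by simp
    next
      case (Lpt A)
      then have "finite {x\<in>A. e \<le> \<bar>h (Pt x) - h (Lpt A)\<bar>}"
        using lim p e by simp
      then have "insert (Lpt A) (Pt ` (A - {x\<in>A. e \<le> \<bar>h (Pt x) - h (Lpt A)\<bar>})) \<in> basic_nbhds \<A> p"
        unfolding Lpt basic_nbhds.simps by blast
      then show ?thesis
        by (rule bexI[rotated]) (use e Lpt in auto)
    next
      case Infty
      obtain \<D> where \<D>: "finite \<D>" "\<D> \<subseteq> \<A>"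
        "\<forall>p\<in>K_points \<A> - (\<Union>A\<in>\<D>. branch A). \<bar>h p - h Infty\<bar> < e"
        using lim e by blast
      then have "K_points \<A> - (\<Union>A\<in>\<D>. branch A) \<in> basic_nbhds \<A> p"
        unfolding Infty basic_nbhds.simps branch_def by blast
      then show ?thesis
        by (rule bexI[rotated]) (use \<D> Infty in auto)
    qed
  qed
  finally show ?thesis .
qed

lemma exists_C_space_K:
  assumes "almost_disjoint \<A>"
    and "\<And>A e. A \<in> \<A> \<Longrightarrow> 0 < e \<Longrightarrow> finite {x\<in>A. e \<le> \<bar>h (Pt x) - h (Lpt A)\<bar>}"
    and "\<And>e. 0 < e \<Longrightarrow> \<exists>\<D>. finite \<D> \<and> \<D> \<subseteq> \<A> \<and>
      (\<forall>p\<in>K_points \<A> - (\<Union>A\<in>\<D>. branch A). \<bar>h p - h Infty\<bar> < e)"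
  shows mk_C_K_space: "mk_C (K_space \<A>) h \<in> C_space (K_space \<A>)"
    and val_mk_C_K_space: "p \<in> K_points \<A> \<Longrightarrow> val (mk_C (K_space \<A>) h) p = h p"
proof -
  have "continuous_map (K_space \<A>) euclideanreal h"
    unfolding continuous_map_K_space_iff[OF assms(1)] using assms(2,3) by blast
  then show "mk_C (K_space \<A>) h \<in> C_space (K_space \<A>)"
    and "p \<in> K_points \<A> \<Longrightarrow> val (mk_C (K_space \<A>) h) p = h p"
    using mk_C[OF compact_space_K_space[OF assms(1)]] by simp_all
qed

lemma continuous_map_val: "f \<in> C_space T \<Longrightarrow> continuous_map T euclideanreal (val f)"
  by (simp add: C_space_def)

lemma C_space_K_limit:
  assumes "almost_disjoint \<A>" "f \<in> C_space (K_space \<A>)" "A \<in> \<A>" "0 < e"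
  shows "finite {x\<in>A. e \<le> \<bar>val f (Pt x) - val f (Lpt A)\<bar>}"
  using continuous_map_K_space_iff[OF assms(1), THEN iffD1, OF continuous_map_val[OF assms(2)]]
    assms(3,4) by blast

lemma C_space_K_infty:
  assumes "almost_disjoint \<A>" "f \<in> C_space (K_space \<A>)" "0 < e"
  obtains \<D> where "finite \<D>" "\<D> \<subseteq> \<A>"
    "\<forall>p\<in>K_points \<A>. (\<forall>A\<in>\<D>. p \<notin> branch A) \<longrightarrow> \<bar>val f p - val f Infty\<bar> < e"
proof -
  obtain \<D> where \<D>: "finite \<D>" "\<D> \<subseteq> \<A>"
    "\<forall>p\<in>K_points \<A> - (\<Union>A\<in>\<D>. branch A). \<bar>val f p - val f Infty\<bar> < e"
    using continuous_map_K_space_iff[OF assms(1), THEN iffD1, THEN conjunct2, rule_format,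
        OF continuous_map_val[OF assms(2)] assms(3)] by (elim exE conjE)
  then show thesis
    by (intro that[of \<D>]) auto
qed

section \<open>Functions carried by a subfamily\<close>

text \<open>The subspace of functions that are constant, with value \<open>f(\<infinity>)\<close>, on the closed set
  \<open>K\<^sub>\<A> - (\<Union>A\<in>\<B>. branch A)\<close>, that is, the image of \<open>C(K\<^sub>\<B>)\<close> under the quotient map
  \<open>K\<^sub>\<A> \<rightarrow> K\<^sub>\<B>\<close> collapsing this set to \<open>\<infinity>\<close>. The condition is spelled out separately
  for the two kinds of points other than \<open>\<infinity>\<close>.\<close>

definition carried :: "'a set set \<Rightarrow> 'a set set \<Rightarrow> ('a kpoint discrete \<Rightarrow>\<^sub>C real) set" where
  "carried \<A> \<B> = {f \<in> C_space (K_space \<A>).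
     (\<forall>A\<in>\<A> - \<B>. val f (Lpt A) = val f Infty) \<and> (\<forall>x\<in>\<Union>\<A> - \<Union>\<B>. val f (Pt x) = val f Infty)}"

lemma carriedD:
  assumes "f \<in> carried \<A> \<B>"
  shows "f \<in> C_space (K_space \<A>)"
    and "A \<in> \<A> \<Longrightarrow> A \<notin> \<B> \<Longrightarrow> val f (Lpt A) = val f Infty"
    and "x \<in> \<Union>\<A> \<Longrightarrow> x \<notin> \<Union>\<B> \<Longrightarrow> val f (Pt x) = val f Infty"
  using assms unfolding carried_def by blast+

lemma carriedI:
  assumes "f \<in> C_space (K_space \<A>)"
    and "\<And>A. A \<in> \<A> \<Longrightarrow> A \<notin> \<B> \<Longrightarrow> val f (Lpt A) = val f Infty"
    and "\<And>x. x \<in> \<Union>\<A> \<Longrightarrow> x \<notin> \<Union>\<B> \<Longrightarrow> val f (Pt x) = val f Infty"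
  shows "f \<in> carried \<A> \<B>"
  using assms unfolding carried_def by blast

lemma carried_mono: "\<B> \<subseteq> \<C> \<Longrightarrow> carried \<A> \<B> \<subseteq> carried \<A> \<C>"
  unfolding carried_def by blast

lemma subspace_carried: "subspace (carried \<A> \<B>)"
proof -
  have "carried \<A> \<B> = C_space (K_space \<A>) \<inter>
      {f. (\<forall>A\<in>\<A> - \<B>. val f (Lpt A) = val f Infty) \<and> (\<forall>x\<in>\<Union>\<A> - \<Union>\<B>. val f (Pt x) = val f Infty)}"
    unfolding carried_def by blast
  moreover have "subspace
      {f. (\<forall>A\<in>\<A> - \<B>. val f (Lpt A) = val f Infty) \<and> (\<forall>x\<in>\<Union>\<A> - \<Union>\<B>. val f (Pt x) = val f Infty)}"
    by (simp add: subspace_def val_add val_scale zero_bcontfun.rep_eq)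
  ultimately show ?thesis
    by (simp only: subspace_inter[OF subspace_C_space])
qed

lemma closed_carried: "closed (carried \<A> \<B>)"
proof -
  have "carried \<A> \<B> = C_space (K_space \<A>) \<inter> (\<Inter>A\<in>\<A> - \<B>. {f. val f (Lpt A) = val f Infty}) \<inter>
      (\<Inter>x\<in>\<Union>\<A> - \<Union>\<B>. {f. val f (Pt x) = val f Infty})"
    unfolding carried_def by blast
  then show ?thesis
    by (simp only:) (intro closed_Int closed_C_space closed_INT ballI closed_Collect_val_eq)
qed

text \<open>Off finitely many branches \<open>f\<close> differs from \<open>f(\<infinity>)\<close> by less than \<open>1/(n+1)\<close>; collect these
  finite families over all \<open>n\<close>.\<close>

lemma countably_carried:
  assumes \<A>: "almost_disjoint \<A>" and f: "f \<in> C_space (K_space \<A>)"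
  obtains \<B> where "countable \<B>" "\<B> \<subseteq> \<A>" "f \<in> carried \<A> \<B>"
proof -
  have "\<exists>\<D>. finite \<D> \<and> \<D> \<subseteq> \<A> \<and> (\<forall>p\<in>K_points \<A> - (\<Union>A\<in>\<D>. branch A).
      \<bar>val f p - val f Infty\<bar> < 1 / real (Suc n))" for n
  proof -
    have "0 < 1 / real (Suc n)"
      by simp
    then show ?thesis
      by (rule C_space_K_infty[OF \<A> f]) (intro exI conjI ballI; blast)
  qed
  then obtain \<D> where \<D>: "\<And>n. finite (\<D> n)" "\<And>n. \<D> n \<subseteq> \<A>"
    "\<And>n p. p \<in> K_points \<A> - (\<Union>A\<in>\<D> n. branch A) \<Longrightarrow>
      \<bar>val f p - val f Infty\<bar> < 1 / real (Suc n)"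
    by metis
  have const: "val f p = val f Infty" if "p \<in> K_points \<A> - (\<Union>A\<in>(\<Union>n. \<D> n). branch A)" for p
  proof (rule ccontr)
    assume "val f p \<noteq> val f Infty"
    then obtain n where "1 / real (Suc n) < \<bar>val f p - val f Infty\<bar>"
      using nat_approx_posE[of "\<bar>val f p - val f Infty\<bar>"] by auto
    moreover have "\<bar>val f p - val f Infty\<bar> < 1 / real (Suc n)"
      using that by (intro \<D>(3)) blast
    ultimately show False
      by simp
  qed
  have "f \<in> carried \<A> (\<Union>n. \<D> n)"
    by (rule carriedI[OF f]; rule const) auto
  moreover have "countable (\<Union>n. \<D> n)"
    using \<D>(1) by (simp add: countable_finite)
  ultimately show thesis
    using \<D>(2) by (intro that) auto
qed

section \<open>Indicators of clopen sets span the subspaces\<close>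

definition ind :: "'a set set \<Rightarrow> 'a kpoint set \<Rightarrow> 'a kpoint discrete \<Rightarrow>\<^sub>C real" where
  "ind \<A> U = mk_C (K_space \<A>) (indicator U)"

text \<open>The hypotheses say that \<open>U\<close> has no boundary at any \<open>l\<^sub>A\<close> and none at \<open>\<infinity>\<close>.\<close>

lemma clopen_ind:
  assumes \<A>: "almost_disjoint \<A>"
    and lim: "\<And>A. A \<in> \<A> \<Longrightarrow> finite {x\<in>A. (Pt x \<in> U) \<noteq> (Lpt A \<in> U)}"
    and inf: "finite \<D>" "\<D> \<subseteq> \<A>"
      "\<And>p. p \<in> K_points \<A> \<Longrightarrow> (\<And>A. A \<in> \<D> \<Longrightarrow> p \<notin> branch A) \<Longrightarrow> (p \<in> U) = (Infty \<in> U)"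
  shows "ind \<A> U \<in> C_space (K_space \<A>)"
    and "p \<in> K_points \<A> \<Longrightarrow> val (ind \<A> U) p = indicator U p"
proof -
  have lim': "finite {x\<in>A. e \<le> \<bar>indicator U (Pt x) - indicator U (Lpt A) :: real\<bar>}"
    if "A \<in> \<A>" "0 < e" for A e
    by (rule finite_subset[OF _ lim[OF that(1)]])
      (use that(2) in \<open>auto simp: indicator_def split: if_splits\<close>)
  have inf': "\<exists>\<D>. finite \<D> \<and> \<D> \<subseteq> \<A> \<and> (\<forall>p\<in>K_points \<A> - (\<Union>A\<in>\<D>. branch A).
      \<bar>indicator U p - indicator U Infty\<bar> < e)" if e: "0 < e" for e :: real
  proof (intro exI conjI ballI)
    fix p assume "p \<in> K_points \<A> - (\<Union>A\<in>\<D>. branch A)"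
    then have "(p \<in> U) = (Infty \<in> U)"
      by (intro inf(3)) auto
    then show "\<bar>indicator U p - indicator U Infty\<bar> < e"
      using e by (simp add: indicator_def)
  qed (fact inf(1,2))+
  show "ind \<A> U \<in> C_space (K_space \<A>)"
    unfolding ind_def by (rule mk_C_K_space[OF \<A> lim' inf'])
  show "p \<in> K_points \<A> \<Longrightarrow> val (ind \<A> U) p = indicator U p"
    unfolding ind_def by (rule val_mk_C_K_space[OF \<A> lim' inf'])
qed

lemma ind_K_points:
  assumes "almost_disjoint \<A>"
  shows "ind \<A> (K_points \<A>) \<in> C_space (K_space \<A>)"
    and "p \<in> K_points \<A> \<Longrightarrow> val (ind \<A> (K_points \<A>)) p = 1"
proof -
  have lim: "finite {x\<in>A. (Pt x \<in> K_points \<A>) \<noteq> (Lpt A \<in> K_points \<A>)}" if "A \<in> \<A>" for A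
    by (rule finite_subset[of _ "{}"]) (use that in auto)
  show "ind \<A> (K_points \<A>) \<in> C_space (K_space \<A>)"
    by (rule clopen_ind[OF assms lim, of "{}"]) auto
  show "val (ind \<A> (K_points \<A>)) p = 1" if "p \<in> K_points \<A>"
    by (subst clopen_ind(2)[OF assms lim, of "{}"]) (use that in auto)
qed

lemma ind_branch:
  assumes "almost_disjoint \<A>" "B \<in> \<A>"
  shows "ind \<A> (branch B) \<in> C_space (K_space \<A>)"
    and "p \<in> K_points \<A> \<Longrightarrow> val (ind \<A> (branch B)) p = indicator (branch B) p"
proof -
  have lim: "finite {x\<in>A. (Pt x \<in> branch B) \<noteq> (Lpt A \<in> branch B)}" if "A \<in> \<A>" for A
  proof (cases "A = B")
    case False
    then have "finite (A \<inter> B)"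
      using assms that by (intro almost_disjointD) auto
    then show ?thesis
      by (rule finite_subset[rotated]) (use False in auto)
  qed simp
  show "ind \<A> (branch B) \<in> C_space (K_space \<A>)"
    by (rule clopen_ind[OF assms(1) lim, of "{B}"]) (use assms(2) in auto)
  show "val (ind \<A> (branch B)) p = indicator (branch B) p" if "p \<in> K_points \<A>"
    by (rule clopen_ind(2)[OF assms(1) lim, of "{B}"]) (use assms(2) that in auto)
qed

lemma ind_point:
  assumes "almost_disjoint \<A>" "y \<in> \<Union>\<A>"
  shows "ind \<A> {Pt y} \<in> C_space (K_space \<A>)"
    and "p \<in> K_points \<A> \<Longrightarrow> val (ind \<A> {Pt y}) p = indicator {Pt y} p"
proof -
  have lim: "finite {x\<in>A. (Pt x \<in> {Pt y}) \<noteq> (Lpt A \<in> {Pt y})}" for A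
    by (rule finite_subset[of _ "{y}"]) auto
  obtain B where B: "B \<in> \<A>" "y \<in> B"
    using assms(2) by blast
  show "ind \<A> {Pt y} \<in> C_space (K_space \<A>)"
    by (rule clopen_ind[OF assms(1) lim, of "{B}"]) (use B in auto)
  show "val (ind \<A> {Pt y}) p = indicator {Pt y} p" if "p \<in> K_points \<A>"
    by (rule clopen_ind(2)[OF assms(1) lim, of "{B}"]) (use B that in auto)
qed

definition gens :: "'a set set \<Rightarrow> 'a set set \<Rightarrow> ('a kpoint discrete \<Rightarrow>\<^sub>C real) set" where
  "gens \<A> \<B> = insert (ind \<A> (K_points \<A>))
     ((\<lambda>A. ind \<A> (branch A)) ` \<B> \<union> (\<lambda>x. ind \<A> {Pt x}) ` \<Union>\<B>)"

lemma gens_subset_carried: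
  assumes \<A>: "almost_disjoint \<A>" and \<B>: "\<B> \<subseteq> \<A>"
  shows "gens \<A> \<B> \<subseteq> carried \<A> \<B>"
proof -
  have "ind \<A> (K_points \<A>) \<in> carried \<A> \<B>"
    by (rule carriedI) (simp_all add: ind_K_points[OF \<A>])
  moreover have "ind \<A> (branch A) \<in> carried \<A> \<B>" if "A \<in> \<B>" for A
    by (rule carriedI) (use that \<B> in \<open>auto simp: ind_branch[OF \<A>] subset_iff indicator_def\<close>)
  moreover have "ind \<A> {Pt x} \<in> carried \<A> \<B>" if "x \<in> \<Union>\<B>" for x
  proof -
    have x: "x \<in> \<Union>\<A>"
      using that \<B> by blast
    show ?thesis
      by (rule carriedI) (use that in \<open>auto simp: ind_point[OF \<A> x] indicator_def\<close>)
  qed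
  ultimately show ?thesis
    unfolding gens_def by blast
qed

text \<open>First \<open>h1\<close> matches \<open>f\<close> at \<open>\<infinity>\<close> and at the finitely many \<open>l\<^sub>A\<close> with \<open>A \<in> \<B>\<close> that a finite family
  \<open>\<D>\<close> good for \<open>f\<close> at \<open>\<infinity>\<close> singles out. The error \<open>g = f - h1\<close> is then less than \<open>e\<close> off the
  branches of \<open>\<D>\<close> and vanishes at their limit points, also at those of members of \<open>\<D>\<close> outside \<open>\<B>\<close>,
  since there \<open>f\<close> agrees with \<open>f(\<infinity>)\<close>. So it reaches \<open>e\<close> at finitely many isolated points only, and
  \<open>h2\<close> removes these one by one.\<close>

lemma carried_approx:
  assumes \<A>: "almost_disjoint \<A>" and \<B>: "\<B> \<subseteq> \<A>" and f: "f \<in> carried \<A> \<B>" and e: "0 < e"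
  shows "\<exists>h\<in>span (gens \<A> \<B>). norm (f - h) \<le> e"
proof -
  obtain \<D> where \<D>: "finite \<D>" "\<D> \<subseteq> \<A>"
    "\<forall>p\<in>K_points \<A>. (\<forall>A\<in>\<D>. p \<notin> branch A) \<longrightarrow> \<bar>val f p - val f Infty\<bar> < e"
    by (rule C_space_K_infty[OF \<A> carriedD(1)[OF f] e])
  define \<D>' where "\<D>' = \<D> \<inter> \<B>"
  have fin': "finite \<D>'"
    using \<D>(1) by (simp add: \<D>'_def)
  define h1 where "h1 = val f Infty *\<^sub>R ind \<A> (K_points \<A>) +
    (\<Sum>A\<in>\<D>'. (val f (Lpt A) - val f Infty) *\<^sub>R ind \<A> (branch A))"
  have h1_span: "h1 \<in> span (gens \<A> \<B>)"
    unfolding h1_def \<D>'_def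
    by (intro span_add span_scale span_sum span_base) (auto simp: gens_def)
  have span_sub: "span (gens \<A> \<B>) \<subseteq> carried \<A> \<B>"
    by (intro span_minimal gens_subset_carried \<A> \<B> subspace_carried)
  have h1: "val h1 p = val f Infty +
      (\<Sum>A\<in>\<D>'. (val f (Lpt A) - val f Infty) * indicator (branch A) p)"
    if p: "p \<in> K_points \<A>" for p
  proof -
    have "val (ind \<A> (branch A)) p = indicator (branch A) p" if "A \<in> \<D>'" for A
      using that p \<D>(2) by (intro ind_branch \<A>) (auto simp: \<D>'_def)
    then show ?thesis
      by (simp add: h1_def val_add val_scale val_sum ind_K_points(2)[OF \<A> p])
  qed
  have h1_off: "val h1 p = val f Infty" if "p \<in> K_points \<A>" "\<And>A. A \<in> \<D>' \<Longrightarrow> p \<notin> branch A" for p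
    using that by (simp add: h1)
  have h1_L: "val h1 (Lpt A) = val f (Lpt A)" if "A \<in> \<D>'" for A
  proof -
    have "val h1 (Lpt A) = val f Infty +
      (\<Sum>B\<in>\<D>'. if B = A then val f (Lpt A) - val f Infty else 0)"
      using that \<D>(2) by (subst h1) (auto simp: \<D>'_def indicator_def intro!: sum.cong)
    then show ?thesis
      using that fin' by simp
  qed
  define g where "g = f - h1"
  have g: "g \<in> carried \<A> \<B>"
    unfolding g_def using h1_span span_sub by (intro subspace_diff[OF subspace_carried f]) auto
  have g_L: "val g (Lpt A) = 0" if "A \<in> \<D>" for A
  proof (cases "A \<in> \<B>")
    case True
    then show ?thesis
      using that h1_L by (simp add: g_def val_diff \<D>'_def)
  next
    case False
    then have "val h1 (Lpt A) = val f Infty"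
      using that \<D>(2) by (intro h1_off) (auto simp: \<D>'_def)
    then show ?thesis
      using carriedD(2)[OF f] that \<D>(2) False by (auto simp: g_def val_diff)
  qed
  have g_off: "\<bar>val g p\<bar> < e" if "p \<in> K_points \<A>" "\<And>A. A \<in> \<D> \<Longrightarrow> p \<notin> branch A" for p
    using \<D>(3) h1_off[of p] that by (auto simp: g_def val_diff \<D>'_def)
  define Z where "Z = {x \<in> \<Union>\<B>. e \<le> \<bar>val g (Pt x)\<bar>}"
  have "Z \<subseteq> (\<Union>A\<in>\<D>. {x\<in>A. e \<le> \<bar>val g (Pt x) - val g (Lpt A)\<bar>})"
  proof
    fix x assume x: "x \<in> Z"
    then have "Pt x \<in> K_points \<A>" "\<not> \<bar>val g (Pt x)\<bar> < e"
      using \<B> by (auto simp: Z_def)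
    then obtain A where "A \<in> \<D>" "x \<in> A"
      using g_off[of "Pt x"] by auto
    then show "x \<in> (\<Union>A\<in>\<D>. {x\<in>A. e \<le> \<bar>val g (Pt x) - val g (Lpt A)\<bar>})"
      using x by (auto simp: Z_def g_L)
  qed
  moreover have "finite (\<Union>A\<in>\<D>. {x\<in>A. e \<le> \<bar>val g (Pt x) - val g (Lpt A)\<bar>})"
    using \<D>(1,2) carriedD(1)[OF g] e by (intro finite_UN_I C_space_K_limit[OF \<A>]) auto
  ultimately have finZ: "finite Z"
    by (rule finite_subset)
  define h2 where "h2 = (\<Sum>x\<in>Z. val g (Pt x) *\<^sub>R ind \<A> {Pt x})"
  have h2_span: "h2 \<in> span (gens \<A> \<B>)"
    unfolding h2_def by (intro span_scale span_sum span_base) (auto simp: gens_def Z_def)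
  have h2: "val h2 p = (\<Sum>x\<in>Z. val g (Pt x) * indicator {Pt x} p)" if p: "p \<in> K_points \<A>" for p
  proof -
    have "val (ind \<A> {Pt x}) p = indicator {Pt x} p" if "x \<in> Z" for x
      using that p \<B> by (intro ind_point \<A>) (auto simp: Z_def)
    then show ?thesis
      by (simp add: h2_def val_scale val_sum)
  qed
  have "norm (g - h2) \<le> e"
  proof (rule norm_le_val)
    show "g - h2 \<in> C_space (K_space \<A>)"
      using h2_span span_sub
      by (intro carriedD(1)[OF subspace_diff[OF subspace_carried g]]) auto
    fix p assume "p \<in> topspace (K_space \<A>)"
    then have p: "p \<in> K_points \<A>"
      by simp
    show "\<bar>val (g - h2) p\<bar> \<le> e"
    proof (cases p)
      case (Pt x)
      have h2x: "val h2 (Pt x) = (if x \<in> Z then val g (Pt x) else 0)"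
      proof -
        have "val h2 (Pt x) = (\<Sum>y\<in>Z. if y = x then val g (Pt x) else 0)"
          using p Pt by (auto simp: h2 indicator_def intro!: sum.cong)
        then show ?thesis
          using finZ by simp
      qed
      show ?thesis
      proof (cases "x \<in> \<Union>\<B>")
        case True
        then show ?thesis
          using e by (auto simp: Pt h2x val_diff Z_def)
      next
        case False
        then have "val g (Pt x) = val f (Pt x) - val f Infty"
          using h1_off[OF p] by (auto simp: Pt g_def val_diff \<D>'_def)
        also have "\<dots> = 0"
          using carriedD(3)[OF f, of x] p False by (auto simp: Pt)
        finally show ?thesis
          using e by (simp add: Pt h2x val_diff)
      qed
    next
      case (Lpt A)
      then have "val h2 p = 0"
        using p by (simp add: h2)
      moreover have "\<bar>val g p\<bar> < e"
        using g_L[of A] g_off[OF p] e by (cases "A \<in> \<D>") (auto simp: Lpt)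
      ultimately show ?thesis
        by (simp add: val_diff)
    next
      case Infty
      then have "val h2 p = 0"
        using p by (simp add: h2)
      moreover have "\<bar>val g p\<bar> < e"
        using g_off[OF p] by (simp add: Infty)
      ultimately show ?thesis
        by (simp add: val_diff)
    qed
  qed (use e in simp)
  then have "norm (f - (h1 + h2)) \<le> e"
    by (simp add: g_def algebra_simps)
  then show ?thesis
    using h1_span h2_span span_add by blast
qed

lemma carried_eq_closure_span:
  assumes \<A>: "almost_disjoint \<A>" and \<B>: "\<B> \<subseteq> \<A>"
  shows "carried \<A> \<B> = closure (span (gens \<A> \<B>))"
proof
  show "closure (span (gens \<A> \<B>)) \<subseteq> carried \<A> \<B>"
    by (intro closure_minimal span_minimal gens_subset_carried \<A> \<B> subspace_carried closed_carried)
  show "carried \<A> \<B> \<subseteq> closure (span (gens \<A> \<B>))"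
  proof
    fix f assume f: "f \<in> carried \<A> \<B>"
    show "f \<in> closure (span (gens \<A> \<B>))"
      unfolding closure_approachable
    proof (intro allI impI)
      fix e :: real assume "e > 0"
      then obtain h where "h \<in> span (gens \<A> \<B>)" "norm (f - h) \<le> e/2"
        using carried_approx[OF \<A> \<B> f, of "e/2"] by auto
      then show "\<exists>h\<in>span (gens \<A> \<B>). dist h f < e"
        using \<open>e > 0\<close> by (intro bexI[of _ h]) (auto simp: dist_norm norm_minus_commute)
    qed
  qed
qed

lemma separable_carried:
  assumes "almost_disjoint \<A>" "\<B> \<subseteq> \<A>" "countable \<B>" "\<forall>A\<in>\<B>. countable A"
  shows "separable_set (carried \<A> \<B>)"
proof -
  have "countable (\<Union>\<B>)"
    using assms(3,4) by (auto intro: countable_UN[of \<B> "\<lambda>A. A", simplified])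
  then have "countable (gens \<A> \<B>)"
    using assms(3) by (simp add: gens_def)
  then show ?thesis
    unfolding carried_eq_closure_span[OF assms(1,2)] by (rule separable_closure_span)
qed

text \<open>Each generator of the limit space already occurs at a finite stage. Monotonicity is asked of
  the subspaces because that is what an increasing sequence in the continuous SCP provides.\<close>

lemma closure_UN_carried:
  assumes \<A>: "almost_disjoint \<A>" and \<B>: "\<And>n::nat. \<B> n \<subseteq> \<A>"
    and mono: "\<And>n. carried \<A> (\<B> n) \<subseteq> carried \<A> (\<B> (Suc n))"
  shows "closure (\<Union>n. carried \<A> (\<B> n)) = carried \<A> (\<Union>n. \<B> n)"
proof
  show "closure (\<Union>n. carried \<A> (\<B> n)) \<subseteq> carried \<A> (\<Union>n. \<B> n)"
    by (intro closure_minimal closed_carried UN_least carried_mono) auto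
  have inc: "carried \<A> (\<B> m) \<subseteq> carried \<A> (\<B> n)" if "m \<le> n" for m n
    using that mono by (rule lift_Suc_mono_le[rotated])
  have "subspace (\<Union>n. carried \<A> (\<B> n))"
    unfolding subspace_def
  proof (intro conjI ballI allI)
    fix x y assume "x \<in> (\<Union>n. carried \<A> (\<B> n))" "y \<in> (\<Union>n. carried \<A> (\<B> n))"
    then obtain m n where "x \<in> carried \<A> (\<B> m)" "y \<in> carried \<A> (\<B> n)"
      by blast
    then have "x \<in> carried \<A> (\<B> (max m n))" "y \<in> carried \<A> (\<B> (max m n))"
      using inc[of m "max m n"] inc[of n "max m n"] by auto
    then show "x + y \<in> (\<Union>n. carried \<A> (\<B> n))"
      using subspace_add[OF subspace_carried] by (intro UN_I[of "max m n"]) auto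
  next
    show "0 \<in> (\<Union>n. carried \<A> (\<B> n))"
      using subspace_0[OF subspace_carried] by blast
    show "a *\<^sub>R x \<in> (\<Union>n. carried \<A> (\<B> n))" if "x \<in> (\<Union>n. carried \<A> (\<B> n))" for a x
      using that subspace_scale[OF subspace_carried] by (elim UN_E) (rule UN_I; simp)
  qed
  moreover have "gens \<A> (\<Union>n. \<B> n) \<subseteq> (\<Union>n. gens \<A> (\<B> n))"
    unfolding gens_def by blast
  then have "gens \<A> (\<Union>n. \<B> n) \<subseteq> (\<Union>n. carried \<A> (\<B> n))"
    using gens_subset_carried[OF \<A> \<B>] by (rule order_trans[OF _ UN_mono[OF subset_refl]])
  ultimately have "span (gens \<A> (\<Union>n. \<B> n)) \<subseteq> (\<Union>n. carried \<A> (\<B> n))"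
    by (rule span_minimal[rotated])
  moreover have "(\<Union>n. \<B> n) \<subseteq> \<A>"
    using \<B> by blast
  ultimately show "carried \<A> (\<Union>n. \<B> n) \<subseteq> closure (\<Union>n. carried \<A> (\<B> n))"
    by (simp only: carried_eq_closure_span[OF \<A>, of "\<Union>n. \<B> n"] closure_mono)
qed

section \<open>Projections between the subspaces\<close>

text \<open>A countable almost disjoint family becomes disjoint after finite changes: assign each point
  to the first member that contains it. A member loses only its intersections with the finitely
  many earlier ones.\<close>

lemma almost_disjoint_selector:
  assumes \<A>: "almost_disjoint \<A>" and \<C>: "\<C> \<subseteq> \<A>" "countable \<C>"
  obtains c where "\<And>x. x \<in> \<Union>\<C> \<Longrightarrow> c x \<in> \<C> \<and> x \<in> c x"
    and "\<And>A. A \<in> \<C> \<Longrightarrow> finite {x\<in>A. c x \<noteq> A}"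
proof -
  let ?m = "\<lambda>x. LEAST n. n \<in> to_nat_on \<C> ` {A\<in>\<C>. x \<in> A}"
  define c where "c x = from_nat_into \<C> (?m x)" for x
  have m: "?m x \<in> to_nat_on \<C> ` {A\<in>\<C>. x \<in> A}" if "x \<in> \<Union>\<C>" for x
    using that by (intro LeastI_ex[of "\<lambda>n. n \<in> to_nat_on \<C> ` {A\<in>\<C>. x \<in> A}"]) auto
  have c: "c x \<in> \<C> \<and> x \<in> c x \<and> to_nat_on \<C> (c x) = ?m x" if "x \<in> \<Union>\<C>" for x
    using m[OF that] \<C>(2) by (auto simp: c_def)
  have "finite {x\<in>A. c x \<noteq> A}" if A: "A \<in> \<C>" for A
  proof (rule finite_subset)
    let ?S = "{B\<in>\<C>. to_nat_on \<C> B < to_nat_on \<C> A}"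
    have "finite (to_nat_on \<C> ` ?S)"
      by (rule finite_subset[of _ "{..<to_nat_on \<C> A}"]) auto
    moreover have "inj_on (to_nat_on \<C>) ?S"
      using inj_on_to_nat_on[OF \<C>(2)] by (rule inj_on_subset) auto
    ultimately have "finite ?S"
      by (rule finite_imageD)
    moreover have "finite (A \<inter> B)" if "B \<in> ?S" for B
      using that A \<C>(1) by (intro almost_disjointD[OF \<A>]) auto
    ultimately show "finite (\<Union>B\<in>?S. A \<inter> B)"
      by blast
    show "{x\<in>A. c x \<noteq> A} \<subseteq> (\<Union>B\<in>?S. A \<inter> B)"
    proof
      fix x assume x: "x \<in> {x\<in>A. c x \<noteq> A}"
      then have cx: "c x \<in> \<C>" "x \<in> c x" "to_nat_on \<C> (c x) = ?m x"
        using A c[of x] by blast+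
      have "?m x \<le> to_nat_on \<C> A"
        by (rule Least_le) (use x A in auto)
      moreover have "to_nat_on \<C> (c x) \<noteq> to_nat_on \<C> A"
        using x A cx(1) to_nat_on_inj[OF \<C>(2)] by blast
      ultimately show "x \<in> (\<Union>B\<in>?S. A \<inter> B)"
        using cx x by auto
    qed
  qed
  then show thesis
    using c by (intro that) auto
qed

text \<open>The projection sends \<open>f\<close> to the function whose value at \<open>x \<in> \<Union>\<B>\<close> is
  \<open>f(x) - (f(l\<^sub>C) - f(\<infinity>))\<close>, where \<open>C = c x\<close> is the selected member of \<open>\<B>' - \<B>\<close> containing \<open>x\<close>, and
  just \<open>f(x)\<close> when \<open>x\<close> lies in no such member. The correction term, called \<open>shift\<close>, makes the
  limit along each \<open>A \<in> \<B>' - \<B>\<close> equal to \<open>f(\<infinity>)\<close>, as membership in \<open>E\<^sub>\<B>\<close> demands. It does no harm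
  elsewhere: \<open>f(l\<^sub>C)\<close> is close to \<open>f(\<infinity>)\<close> for all but finitely many \<open>C\<close>, and a set
  \<open>A\<close> outside \<open>\<B>' - \<B>\<close> meets each of these finitely many in a finite set. Hence the correction
  tends to \<open>0\<close> along \<open>A\<close>, and also at \<open>\<infinity>\<close>. On \<open>E\<^sub>\<B>\<close> it is \<open>0\<close>.\<close>

lemma projection_carried:
  assumes \<A>: "almost_disjoint \<A>" and sub: "\<B> \<subseteq> \<B>'" "\<B>' \<subseteq> \<A>" and cnt: "countable \<B>'"
  obtains R where "projection_on (carried \<A> \<B>') R" "R ` carried \<A> \<B>' = carried \<A> \<B>"
proof -
  define \<C> where "\<C> = \<B>' - \<B>"
  have \<C>: "\<C> \<subseteq> \<A>" "countable \<C>"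
    using sub cnt by (auto simp: \<C>_def)
  obtain c where c: "\<And>x. x \<in> \<Union>\<C> \<Longrightarrow> c x \<in> \<C> \<and> x \<in> c x"
    and c_fin: "\<And>A. A \<in> \<C> \<Longrightarrow> finite {x\<in>A. c x \<noteq> A}"
    using almost_disjoint_selector[OF \<A> \<C>] by metis
  define shift :: "('a kpoint discrete \<Rightarrow>\<^sub>C real) \<Rightarrow> 'a \<Rightarrow> real" where
    "shift = (\<lambda>f x. if x \<in> \<Union>\<C> then val f (Lpt (c x)) - val f Infty else 0)"
  define r :: "('a kpoint discrete \<Rightarrow>\<^sub>C real) \<Rightarrow> 'a kpoint \<Rightarrow> real" where
    "r = (\<lambda>f p. case p of
        Pt x \<Rightarrow> if x \<in> \<Union>\<B> then val f (Pt x) - shift f x else val f Infty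
      | Lpt A \<Rightarrow> if A \<in> \<B> then val f (Lpt A) else val f Infty
      | Infty \<Rightarrow> val f Infty)"
  define R where "R = (\<lambda>f. mk_C (K_space \<A>) (r f))"
  have r_simps: "r f (Pt x) = (if x \<in> \<Union>\<B> then val f (Pt x) - shift f x else val f Infty)"
      "r f (Lpt A) = (if A \<in> \<B> then val f (Lpt A) else val f Infty)"
      "r f Infty = val f Infty" for f x A
    by (simp_all add: r_def)
  \<comment> \<open>The set \<open>c x\<close> is the only member of \<open>\<C>\<close> that matters for \<open>shift f x\<close>, so it is enough that
    \<open>c x\<close> avoids the finite family \<open>\<D>\<close> off whose branches \<open>f\<close> is close to \<open>f(\<infinity>)\<close>.\<close>
  have shift_small: "\<bar>shift f x\<bar> < e"
    if f: "f \<in> carried \<A> \<B>'" and e: "0 < e" and x: "\<And>A. A \<in> \<D> \<Longrightarrow> A \<in> \<C> \<Longrightarrow> x \<in> A \<Longrightarrow> c x \<noteq> A"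
      and \<D>: "\<forall>p\<in>K_points \<A>. (\<forall>A\<in>\<D>. p \<notin> branch A) \<longrightarrow> \<bar>val f p - val f Infty\<bar> < e"
    for f x e \<D>
  proof (cases "x \<in> \<Union>\<C>")
    case True
    then have cx: "c x \<in> \<C>" "x \<in> c x"
      using c by auto
    then have "c x \<notin> \<D>"
      using x by blast
    then have "\<bar>val f (Lpt (c x)) - val f Infty\<bar> < e"
      using cx(1) \<C>(1) by (intro \<D>[rule_format]) auto
    then show ?thesis
      using True by (simp add: shift_def)
  qed (use e in \<open>simp add: shift_def\<close>)
  have lim: "finite {x\<in>A. e \<le> \<bar>r f (Pt x) - r f (Lpt A)\<bar>}"
    if f: "f \<in> carried \<A> \<B>'" and A: "A \<in> \<A>" and e: "0 < e" for f A e
  proof (cases "A \<in> \<C>")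
    case True
    \<comment> \<open>Where \<open>c x = A\<close>, the correction turns the distance of \<open>r f\<close> from \<open>f(\<infinity>)\<close> into that of \<open>f\<close>
      from \<open>f(l\<^sub>A)\<close>.\<close>
    let ?bad = "{x\<in>A. e \<le> \<bar>val f (Pt x) - val f (Lpt A)\<bar>} \<union> {x\<in>A. c x \<noteq> A}"
    have "finite ?bad"
      using C_space_K_limit[OF \<A> carriedD(1)[OF f] A e] c_fin[OF True] by simp
    moreover have "{x\<in>A. e \<le> \<bar>r f (Pt x) - r f (Lpt A)\<bar>} \<subseteq> ?bad"
      using True e by (auto simp: r_simps shift_def \<C>_def split: if_splits)
    ultimately show ?thesis
      by (rule finite_subset[rotated])
  next
    case False
    obtain \<D> where \<D>: "finite \<D>" "\<D> \<subseteq> \<A>"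
      "\<forall>p\<in>K_points \<A>. (\<forall>A\<in>\<D>. p \<notin> branch A) \<longrightarrow> \<bar>val f p - val f Infty\<bar> < e/2"
      by (rule C_space_K_infty[OF \<A> carriedD(1)[OF f] half_gt_zero[OF e]])
    have rL: "r f (Lpt A) = val f (Lpt A)"
      using carriedD(2)[OF f A] False by (auto simp: r_simps \<C>_def)
    let ?bad = "{x\<in>A. e/2 \<le> \<bar>val f (Pt x) - val f (Lpt A)\<bar>} \<union> (\<Union>D\<in>\<D> \<inter> \<C>. A \<inter> D)"
    have "finite (A \<inter> D)" if "D \<in> \<D> \<inter> \<C>" for D
      using that A False \<D>(2) by (intro almost_disjointD[OF \<A>]) auto
    then have "finite (\<Union>D\<in>\<D> \<inter> \<C>. A \<inter> D)"
      using \<D>(1) by (intro finite_UN_I) auto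
    then have "finite ?bad"
      using C_space_K_limit[OF \<A> carriedD(1)[OF f] A, of "e/2"] e by simp
    moreover have "{x\<in>A. e \<le> \<bar>r f (Pt x) - r f (Lpt A)\<bar>} \<subseteq> ?bad"
    proof (rule subsetI, rule ccontr)
      fix x assume x: "x \<in> {x\<in>A. e \<le> \<bar>r f (Pt x) - r f (Lpt A)\<bar>}" and "x \<notin> ?bad"
      then have near: "\<bar>val f (Pt x) - val f (Lpt A)\<bar> < e/2"
        and out: "\<And>D. D \<in> \<D> \<Longrightarrow> D \<in> \<C> \<Longrightarrow> x \<notin> D"
        by auto
      have "\<bar>shift f x\<bar> < e/2"
      proof (rule shift_small[OF f _ _ \<D>(3)])
        show "c x \<noteq> D" if "D \<in> \<D>" "D \<in> \<C>" "x \<in> D" for D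
          using out that by blast
      qed (use e in simp)
      moreover have "r f (Pt x) = val f (Pt x) - shift f x \<or> r f (Pt x) = r f (Lpt A)"
        using x by (auto simp: r_simps)
      ultimately have "\<bar>r f (Pt x) - r f (Lpt A)\<bar> < e"
        using near rL e by linarith
      then show False
        using x by simp
    qed
    ultimately show ?thesis
      by (rule finite_subset[rotated])
  qed
  have inf: "\<exists>\<D>. finite \<D> \<and> \<D> \<subseteq> \<A> \<and> (\<forall>p\<in>K_points \<A> - (\<Union>A\<in>\<D>. branch A).
      \<bar>r f p - r f Infty\<bar> < e)" if f: "f \<in> carried \<A> \<B>'" and e: "0 < e" for f e
  proof -
    obtain \<D> where \<D>: "finite \<D>" "\<D> \<subseteq> \<A>"
      "\<forall>p\<in>K_points \<A>. (\<forall>A\<in>\<D>. p \<notin> branch A) \<longrightarrow> \<bar>val f p - val f Infty\<bar> < e/2"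
      by (rule C_space_K_infty[OF \<A> carriedD(1)[OF f] half_gt_zero[OF e]])
    have "\<bar>r f p - r f Infty\<bar> < e"
      if p: "p \<in> K_points \<A>" and off: "\<forall>A\<in>\<D>. p \<notin> branch A" for p
    proof -
      have near: "\<bar>val f p - val f Infty\<bar> < e/2"
        using \<D>(3) p off by blast
      show ?thesis
      proof (cases p)
        case (Pt x)
        have "\<bar>shift f x\<bar> < e/2"
        proof (rule shift_small[OF f _ _ \<D>(3)])
          show "c x \<noteq> D" if "D \<in> \<D>" "D \<in> \<C>" "x \<in> D" for D
            using off Pt that by simp
        qed (use e in simp)
        then have "\<bar>val f (Pt x) - shift f x - val f Infty\<bar> < e"
          using near unfolding Pt by linarith
        then show ?thesis
          using e by (simp add: Pt r_simps)
      qed (use near e in \<open>simp_all add: r_simps\<close>)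
    qed
    then show ?thesis
      using \<D>(1,2) by (intro exI[of _ \<D>] conjI ballI) auto
  qed
  have val_R: "val (R f) p = r f p" if "f \<in> carried \<A> \<B>'" "p \<in> K_points \<A>" for f p
    unfolding R_def by (rule val_mk_C_K_space[OF \<A> lim[OF that(1)] inf[OF that(1)] that(2)])
  have R_in: "R f \<in> carried \<A> \<B>" if f: "f \<in> carried \<A> \<B>'" for f
  proof (rule carriedI)
    show "R f \<in> C_space (K_space \<A>)"
      unfolding R_def by (rule mk_C_K_space[OF \<A> lim[OF f] inf[OF f]])
  qed (use f in \<open>auto simp: val_R r_simps\<close>)
  have R_id: "R f = f" if f: "f \<in> carried \<A> \<B>" for f
  proof (rule C_space_eqI)
    have f': "f \<in> carried \<A> \<B>'"
      using f carried_mono[OF sub(1)] by blast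
    have "shift f x = 0" for x
      using c[of x] carriedD(2)[OF f, of "c x"] \<C>(1) by (auto simp: shift_def \<C>_def)
    then show "val (R f) p = val f p" if "p \<in> topspace (K_space \<A>)" for p
      using that carriedD(2,3)[OF f] by (cases p) (auto simp: val_R[OF f'] r_simps)
    show "R f \<in> C_space (K_space \<A>)" "f \<in> C_space (K_space \<A>)"
      using R_in[OF f'] f carriedD(1) by auto
  qed
  have r_add: "r (f + g) p = r f p + r g p" for f g p
    by (cases p) (auto simp: r_simps shift_def val_add)
  have r_scale: "r (a *\<^sub>R f) p = a * r f p" for a f p
    by (cases p) (auto simp: r_simps shift_def val_scale algebra_simps)
  have r_bound: "\<bar>r f p\<bar> \<le> 3 * norm f" for f p
  proof (cases p)
    case (Pt x)
    show ?thesis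
      using abs_val_le[of f "Pt x"] abs_val_le[of f "Lpt (c x)"] abs_val_le[of f Infty]
      by (auto simp: Pt r_simps shift_def)
  next
    case (Lpt A)
    show ?thesis
      using abs_val_le[of f "Lpt A"] abs_val_le[of f Infty] by (auto simp: Lpt r_simps)
  next
    case Infty
    show ?thesis
      using abs_val_le[of f Infty] by (auto simp: Infty r_simps)
  qed
  have R_in': "R f \<in> carried \<A> \<B>'" if "f \<in> carried \<A> \<B>'" for f
    using R_in[OF that] carried_mono[OF sub(1)] by blast
  have "projection_on (carried \<A> \<B>') R"
    unfolding projection_on_def
  proof (intro conjI ballI allI exI)
    show "R \<in> carried \<A> \<B>' \<rightarrow> carried \<A> \<B>'"
      using R_in' by blast
  next
    fix f g assume f: "f \<in> carried \<A> \<B>'" and g: "g \<in> carried \<A> \<B>'"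
    have fg: "f + g \<in> carried \<A> \<B>'"
      by (rule subspace_add[OF subspace_carried f g])
    show "R (f + g) = R f + R g"
    proof (rule C_space_eqI)
      show "R (f + g) \<in> C_space (K_space \<A>)" "R f + R g \<in> C_space (K_space \<A>)"
        by (rule carriedD(1)[OF R_in'[OF fg]],
            rule carriedD(1)[OF subspace_add[OF subspace_carried R_in'[OF f] R_in'[OF g]]])
    qed (simp add: val_R f g fg val_add r_add)
  next
    fix a f assume f: "f \<in> carried \<A> \<B>'"
    have af: "a *\<^sub>R f \<in> carried \<A> \<B>'"
      by (rule subspace_scale[OF subspace_carried f])
    show "R (a *\<^sub>R f) = a *\<^sub>R R f"
    proof (rule C_space_eqI)
      show "R (a *\<^sub>R f) \<in> C_space (K_space \<A>)" "a *\<^sub>R R f \<in> C_space (K_space \<A>)"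
        by (rule carriedD(1)[OF R_in'[OF af]],
            rule carriedD(1)[OF subspace_scale[OF subspace_carried R_in'[OF f]]])
    qed (simp add: val_R f af val_scale r_scale)
  next
    fix f assume f: "f \<in> carried \<A> \<B>'"
    show "norm (R f) \<le> 3 * norm f"
      by (rule norm_le_val[OF carriedD(1)[OF R_in[OF f]]]) (simp_all add: val_R f r_bound)
    show "R (R f) = R f"
      using R_id R_in f by blast
  qed
  moreover have "R ` carried \<A> \<B>' = carried \<A> \<B>"
    using R_in R_id carried_mono[OF sub(1)] by force
  ultimately show thesis
    by (rule that)
qed

text \<open>Since the projection \<open>P\<close> is the identity on its range, composing it with \<open>R\<close> requires of
  the domain \<open>F\<close> of \<open>R\<close> only that it lies between \<open>P ` E\<close> and \<open>E\<close>.\<close>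

lemma complemented_in_trans:
  fixes E :: "'b::real_normed_vector set"
  assumes P: "projection_on E P" and E: "P ` E \<subseteq> F" "F \<subseteq> E"
    and R: "projection_on F R" "R ` F = G" "G \<subseteq> P ` E"
  shows "complemented_in E G"
proof -
  have P_id: "P x = x" if "x \<in> P ` E" for x
    using that P by (auto simp: projection_on_def)
  have R_id: "R x = x" if "x \<in> G" for x
    using that R by (auto simp: projection_on_def)
  have PE: "P x \<in> F" if "x \<in> E" for x
    using that E(1) by blast
  have RP: "R (P x) \<in> G" if "x \<in> E" for x
    using PE[OF that] R(2) by blast
  obtain b where b: "\<forall>x\<in>E. norm (P x) \<le> b * norm x"
    using P by (auto simp: projection_on_def)
  obtain b' where b': "\<forall>x\<in>F. norm (R x) \<le> b' * norm x"
    using R(1) by (auto simp: projection_on_def)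
  have "projection_on E (R \<circ> P)"
    unfolding projection_on_def
  proof (intro conjI ballI allI exI)
    show "R \<circ> P \<in> E \<rightarrow> E"
      using RP subset_trans[OF R(3) subset_trans[OF E]] by auto
    show "(R \<circ> P) (x + y) = (R \<circ> P) x + (R \<circ> P) y" if "x \<in> E" "y \<in> E" for x y
      using that PE P R(1) by (simp add: projection_on_def)
    show "(R \<circ> P) (a *\<^sub>R x) = a *\<^sub>R (R \<circ> P) x" if "x \<in> E" for a x
      using that PE P R(1) by (simp add: projection_on_def)
    show "(R \<circ> P) ((R \<circ> P) x) = (R \<circ> P) x" if "x \<in> E" for x
      using P_id[OF subsetD[OF R(3) RP[OF that]]] R_id[OF RP[OF that]] by simp
    show "norm ((R \<circ> P) x) \<le> (\<bar>b'\<bar> * \<bar>b\<bar>) * norm x" if "x \<in> E" for x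
    proof -
      have "norm (P x) \<le> b * norm x"
        using b that by blast
      also have "\<dots> \<le> \<bar>b\<bar> * norm x"
        by (rule mult_right_mono) simp_all
      finally have Px: "norm (P x) \<le> \<bar>b\<bar> * norm x" .
      have "norm ((R \<circ> P) x) \<le> b' * norm (P x)"
        using b' PE[OF that] by simp
      also have "\<dots> \<le> \<bar>b'\<bar> * norm (P x)"
        by (rule mult_right_mono) simp_all
      also have "\<dots> \<le> \<bar>b'\<bar> * (\<bar>b\<bar> * norm x)"
        by (rule mult_left_mono[OF Px]) simp
      finally show ?thesis
        by (simp add: mult.assoc)
    qed
  qed
  moreover have "(R \<circ> P) ` E = G"
  proof
    show "G \<subseteq> (R \<circ> P) ` E"
    proof
      fix x assume x: "x \<in> G"
      then have "x = (R \<circ> P) x"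
        using P_id[OF subsetD[OF R(3)]] R_id by simp
      moreover have "x \<in> E"
        using x R(3) E by blast
      ultimately show "x \<in> (R \<circ> P) ` E"
        by (rule image_eqI)
    qed
  qed (use RP in auto)
  ultimately show ?thesis
    unfolding complemented_in_def by metis
qed

section \<open>The equivalence\<close>

text \<open>The separable complemented space \<open>F\<close> given by the SCP need not have the form \<open>E\<^sub>\<X>\<close>, but a dense
  sequence of \<open>F\<close> involves only countably many members of \<open>\<A>\<close>, so \<open>F\<close> is squeezed between two
  spaces of this form.\<close>

lemma SCP_imp_carried_complemented:
  assumes \<A>: "almost_disjoint \<A>" and cnt: "\<forall>A\<in>\<A>. countable A"
    and scp: "SCP (C_space (K_space \<A>))"
    and \<B>: "\<B> \<subseteq> \<A>" "countable \<B>"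
  shows "complemented_in (C_space (K_space \<A>)) (carried \<A> \<B>)"
proof -
  let ?E = "C_space (K_space \<A>)"
  have carried_E: "carried \<A> \<X> \<subseteq> ?E" for \<X>
    using carriedD(1) by blast
  have "separable_set (carried \<A> \<B>)"
    using \<B> cnt by (intro separable_carried \<A>) auto
  then obtain F where F: "carried \<A> \<B> \<subseteq> F" "separable_set F" "complemented_in ?E F"
    using scp subspace_carried carried_E unfolding SCP_def by metis
  obtain P where P: "projection_on ?E P" "F = P ` ?E"
    using F(3) unfolding complemented_in_def by blast
  obtain C where C: "countable C" "C \<subseteq> F" "F \<subseteq> closure C"
    using F(2) by (rule separable_setE)
  have "\<exists>\<X>. countable \<X> \<and> \<X> \<subseteq> \<A> \<and> f \<in> carried \<A> \<X>" if "f \<in> C" for f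
  proof -
    have "f \<in> ?E"
      using that C(2) P by (auto simp: projection_on_def)
    then show ?thesis
      by (metis countably_carried[OF \<A>])
  qed
  then obtain \<X> where \<X>: "\<And>f. f \<in> C \<Longrightarrow> countable (\<X> f) \<and> \<X> f \<subseteq> \<A> \<and> f \<in> carried \<A> (\<X> f)"
    by metis
  define \<B>' where "\<B>' = \<B> \<union> (\<Union>f\<in>C. \<X> f)"
  have \<B>': "\<B> \<subseteq> \<B>'" "\<B>' \<subseteq> \<A>" "countable \<B>'"
    using \<B> \<X> C(1) by (auto simp: \<B>'_def)
  have "C \<subseteq> carried \<A> \<B>'"
  proof
    fix f assume "f \<in> C"
    then show "f \<in> carried \<A> \<B>'"
      using \<X> carried_mono[of "\<X> f" \<B>' \<A>] by (auto simp: \<B>'_def)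
  qed
  then have "F \<subseteq> carried \<A> \<B>'"
    using C(3) closure_minimal[OF _ closed_carried] by blast
  moreover obtain R where R: "projection_on (carried \<A> \<B>') R" "R ` carried \<A> \<B>' = carried \<A> \<B>"
    by (rule projection_carried[OF \<A> \<B>'])
  ultimately show ?thesis
    using P F(1) carried_E by (intro complemented_in_trans[OF P(1) _ _ R]) auto
qed

theorem theorem1p2:
  fixes \<A> :: "'a set set"
  assumes "almost_disjoint \<A>"
    and "\<forall>A\<in>\<A>. countable A"
  shows "continuous_SCP (C_space (K_space \<A>)) \<longleftrightarrow> SCP (C_space (K_space \<A>))"
proof
  let ?E = "C_space (K_space \<A>)"
  assume scp: "SCP ?E"
  define \<F> where "\<F> = carried \<A> ` {\<B>. \<B> \<subseteq> \<A> \<and> countable \<B>}"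
  have \<F>I: "carried \<A> \<B> \<in> \<F>" if "\<B> \<subseteq> \<A>" "countable \<B>" for \<B>
    unfolding \<F>_def by (rule imageI) (simp add: that)
  have \<F>E: "\<exists>\<B>. F = carried \<A> \<B> \<and> \<B> \<subseteq> \<A> \<and> countable \<B>" if "F \<in> \<F>" for F
    using that unfolding \<F>_def by (elim imageE) auto
  show "continuous_SCP ?E"
    unfolding continuous_SCP_def
  proof (intro exI[of _ \<F>] conjI ballI allI impI)
    fix F assume "F \<in> \<F>"
    then obtain \<B> where \<B>: "F = carried \<A> \<B>" "\<B> \<subseteq> \<A>" "countable \<B>"
      using \<F>E by meson
    have "\<forall>A\<in>\<B>. countable A"
      using assms(2) \<B>(2) by blast
    then show "separable_set F"
      unfolding \<B>(1) by (rule separable_carried[OF assms(1) \<B>(2,3)])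
    show "complemented_in ?E F"
      unfolding \<B>(1) by (rule SCP_imp_carried_complemented[OF assms scp \<B>(2,3)])
  next
    show "?E = \<Union>\<F>"
    proof (intro equalityI subsetI)
      fix f assume "f \<in> ?E"
      then obtain \<B> where "countable \<B>" "\<B> \<subseteq> \<A>" "f \<in> carried \<A> \<B>"
        by (rule countably_carried[OF assms(1)])
      then show "f \<in> \<Union>\<F>"
        using \<F>I by (intro UnionI)
    next
      fix f assume "f \<in> \<Union>\<F>"
      then obtain F where "F \<in> \<F>" "f \<in> F"
        by (rule UnionE)
      then show "f \<in> ?E"
        using \<F>E[of F] carriedD(1) by auto
    qed
  next
    fix F G assume "F \<in> \<F>" "G \<in> \<F>"
    then obtain \<B> \<C> where \<B>: "F = carried \<A> \<B>" "\<B> \<subseteq> \<A>" "countable \<B>"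
      and \<C>: "G = carried \<A> \<C>" "\<C> \<subseteq> \<A>" "countable \<C>"
      using \<F>E by meson
    show "\<exists>H\<in>\<F>. F \<subseteq> H \<and> G \<subseteq> H"
    proof (intro bexI conjI)
      show "carried \<A> (\<B> \<union> \<C>) \<in> \<F>"
        using \<B> \<C> by (intro \<F>I) auto
      show "F \<subseteq> carried \<A> (\<B> \<union> \<C>)" "G \<subseteq> carried \<A> (\<B> \<union> \<C>)"
        unfolding \<B>(1) \<C>(1) by (intro carried_mono; blast)+
    qed
  next
    fix F :: "nat \<Rightarrow> ('a kpoint discrete \<Rightarrow>\<^sub>C real) set"
    assume F: "range F \<subseteq> \<F> \<and> (\<forall>n. F n \<subseteq> F (Suc n))"
    have "\<forall>n. \<exists>\<B>. F n = carried \<A> \<B> \<and> \<B> \<subseteq> \<A> \<and> countable \<B>"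
    proof
      fix n
      have "F n \<in> \<F>"
        using F by (intro subsetD[of "range F" \<F>]) simp_all
      then show "\<exists>\<B>. F n = carried \<A> \<B> \<and> \<B> \<subseteq> \<A> \<and> countable \<B>"
        by (rule \<F>E)
    qed
    from choice[OF this] obtain \<B> where
      \<B>: "\<forall>n. F n = carried \<A> (\<B> n) \<and> \<B> n \<subseteq> \<A> \<and> countable (\<B> n)"
      by (elim exE)
    then have "closure (\<Union>n. F n) = carried \<A> (\<Union>n. \<B> n)"
      using F closure_UN_carried[OF assms(1), of \<B>] by simp
    moreover have "carried \<A> (\<Union>n. \<B> n) \<in> \<F>"
      using \<B> by (intro \<F>I) auto
    ultimately show "closure (\<Union>n. F n) \<in> \<F>"
      by simp
  qed
qed (rule continuous_SCP_imp_SCP)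

end
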